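(* Let $K:\mathbb B_d\times\mathbb B_d\to\mathcal M_d(\mathbb C)$ be a non-negative definite kernel of the form $$K(\boldsymbol z,\boldsymbol w)=\sum_{\ell=1}^\infty(\tilde a_{\ell,1}-\tilde a_{\ell,2})\langle\boldsymbol z,\boldsymbol w\rangle^{\ell-1}\boldsymbol z\bar{\boldsymbol w}^\dagger+\sum_{\ell=0}^\infty\tilde a_{\ell,2}\langle\boldsymbol z,\boldsymbol w\rangle^\ell I_d,$$ with complex numbers $\tilde a_{\ell,1}$ ($\ell\ge1$), $\tilde a_{\ell,2}$ ($\ell\ge0$), and set $\tilde a_{0,1}:=\tilde a_{0,2}$. Then the $d$-tuple $\boldsymbol M$ of multiplication by the coordinate functions on $\mathcal H_K(\mathbb B_d,\mathbb C^d)$ is bounded if and only if $$\sup_{\ell\ge1}\Big\{\frac{(\ell+d-1)\tilde a_{\ell-1,1}-(d-1)\tilde a_{\ell-1,2}}{(\ell+d-1)\tilde a_{\ell,1}-(d-1)\tilde a_{\ell,2}},\ \frac{\tilde a_{\ell-1,2}}{\tilde a_{\ell,2}}\Big\}<\infty.$$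
   Context: $\mathbb B_d$ is the unit ball of $\mathbb C^d$, $\langle\boldsymbol z,\boldsymbol w\rangle=\sum_iz_i\bar w_i$, and $\boldsymbol z\bar{\boldsymbol w}^\dagger$ is the $d\times d$ matrix with $(i,j)$ entry $z_i\bar w_j$. $\mathcal H_K(\mathbb B_d,\mathbb C^d)$ is the reproducing kernel Hilbert space of $\mathbb C^d$-valued holomorphic functions with kernel $K$.
   Formalization: The formal theorem assumes d ≥ 2 (for d = 1 the kernel does not depend on ã_{ℓ,2}, ℓ ≥ 1, and the claim fails) and that all denominators in the quotients are non-zero for ℓ ≥ 1; "sup < ∞" is stated as a uniform bound on the moduli of the quotients. *)

theory Defs
  imports "HOL-Analysis.Analysis"
begin

definition cinner :: "complex^'n \<Rightarrow> complex^'n \<Rightarrow> complex" where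
  "cinner z w = (\<Sum>i\<in>UNIV. z$i * cnj (w$i))"

text \<open>Gram form of a finite family (w_j, xi_j): sum over i,j of <K(w_i,w_j) xi_j, xi_i>,
  i.e. the squared norm of sum_j K(.,w_j) xi_j in H_K.\<close>
definition gram_form ::
  "(complex^'n \<Rightarrow> complex^'n \<Rightarrow> complex^'n^'n) \<Rightarrow> nat \<Rightarrow> (nat \<Rightarrow> complex^'n) \<Rightarrow> (nat \<Rightarrow> complex^'n) \<Rightarrow> complex" where
  "gram_form K m ws xis = (\<Sum>i<m. \<Sum>j<m. cinner (K (ws i) (ws j) *v xis j) (xis i))"

definition nonneg_def_kernel :: "(complex^'n \<Rightarrow> complex^'n \<Rightarrow> complex^'n^'n) \<Rightarrow> bool" where
  "nonneg_def_kernel K \<longleftrightarrow>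
     (\<forall>(m::nat) (ws::nat \<Rightarrow> complex^'n) (xis::nat \<Rightarrow> complex^'n).
        (\<forall>j<m. ws j \<in> ball 0 1) \<longrightarrow>
          Im (gram_form K m ws xis) = 0 \<and> Re (gram_form K m ws xis) \<ge> 0)"

text \<open>Reproducing kernel Hilbert space H_K(B_d, C^d) (Aronszajn): a function f on the ball
  belongs to H_K iff the functional sum_j K(.,w_j) xi_j |-> sum_j <f(w_j), xi_j> is bounded
  on the (dense) span of the kernel functions; its norm is then the operator norm of that
  functional, which equals the H_K norm of f.\<close>
definition rk_vals :: "(complex^'n \<Rightarrow> complex^'n \<Rightarrow> complex^'n^'n) \<Rightarrow> (complex^'n \<Rightarrow> complex^'n) \<Rightarrow> real set" where
  "rk_vals K f = {norm (\<Sum>j<m. cinner (f (ws j)) (xis j)) | m ws xis.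
      (\<forall>j<m. ws j \<in> ball 0 1) \<and> Re (gram_form K m ws xis) \<le> 1}"

definition in_RKHS :: "(complex^'n \<Rightarrow> complex^'n \<Rightarrow> complex^'n^'n) \<Rightarrow> (complex^'n \<Rightarrow> complex^'n) \<Rightarrow> bool" where
  "in_RKHS K f \<longleftrightarrow> bdd_above (rk_vals K f)"

definition rk_norm :: "(complex^'n \<Rightarrow> complex^'n \<Rightarrow> complex^'n^'n) \<Rightarrow> (complex^'n \<Rightarrow> complex^'n) \<Rightarrow> real" where
  "rk_norm K f = Sup (rk_vals K f)"

definition mult_coord :: "'n \<Rightarrow> (complex^'n \<Rightarrow> complex^'n) \<Rightarrow> (complex^'n \<Rightarrow> complex^'n)" where
  "mult_coord i f = (\<lambda>z. (z$i) *s f z)"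

definition coord_mult_bounded :: "(complex^'n \<Rightarrow> complex^'n \<Rightarrow> complex^'n^'n) \<Rightarrow> bool" where
  "coord_mult_bounded K \<longleftrightarrow>
     (\<forall>i::'n. \<exists>C::real. \<forall>f. in_RKHS K f \<longrightarrow>
         in_RKHS K (mult_coord i f) \<and> rk_norm K (mult_coord i f) \<le> C * rk_norm K f)"

definition at1 :: "(nat \<Rightarrow> complex) \<Rightarrow> (nat \<Rightarrow> complex) \<Rightarrow> nat \<Rightarrow> complex" where
  "at1 a1 a2 l = (if l = 0 then a2 0 else a1 l)"

end

theory Submission
  imports Defs
begin

text \<open>
  The operators \<open>M\<^sub>k\<close> are bounded iff \<open>(C - \<langle>z, w\<rangle>) K(z, w)\<close> is non-negative definite for some \<open>C\<close>,
  because the adjoint of \<open>M\<^sub>k\<close> maps \<open>K(\<cdot>, w) \<xi>\<close> to the multiple of it by the conjugate of \<open>w\<^sub>k\<close>.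
  Multiplication by \<open>\<langle>z, w\<rangle>\<close> only shifts the coefficients, so this kernel has the same shape as \<open>K\<close>,
  and it remains to describe non-negativity in terms of coefficients. Averaging over roots of unity
  isolates the homogeneous part of degree \<open>l\<close>. The \<open>\<complex>\<^sup>d\<close>-valued polynomials of degree \<open>l\<close> are the
  orthogonal sum of the multiples \<open>z f(z)\<close> and the divergence-free ones, and with
  \<open>p = a\<^sub>1 - a\<^sub>2\<close>, \<open>q = a\<^sub>2\<close> the kernel acts on these two summands by the scalars \<open>((l + d - 1) p + l q) / l\<close>
  and \<open>q\<close>.
\<close>

section \<open>Positive forms and homogeneous kernels\<close>

lemma cinner_add_left: "cinner (x + y) z = cinner x z + cinner y z"
  by (simp add: cinner_def algebra_simps sum.distrib)

lemma cinner_scale_left: "cinner (c *s x) z = c * cinner x z"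
  by (simp add: cinner_def algebra_simps sum_distrib_left)

lemma cinner_scale_right: "cinner x (c *s z) = cnj c * cinner x z"
  by (simp add: cinner_def algebra_simps sum_distrib_left)

lemma cinner_sum_left: "cinner (\<Sum>i\<in>A. f i) z = (\<Sum>i\<in>A. cinner (f i) z)"
  unfolding cinner_def sum_component sum_distrib_right by (rule sum.swap)

lemma cnj_cinner: "cnj (cinner x y) = cinner y x"
  by (simp add: cinner_def mult.commute)

lemma cinner_axis_right: "cinner x (axis k c) = x $ k * cnj c"
  by (simp add: cinner_def axis_def if_distrib sum.delta cong: if_cong)

lemma cinner_axis_left: "cinner (axis k c) x = c * cnj (x $ k)"
  by (metis cinner_axis_right cnj_cinner complex_cnj_cnj complex_cnj_mult mult.commute)

text \<open>Stated for an arbitrary set \<open>S\<close>, since a homogeneous part is tested on the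
  whole space and the kernel only on the ball.\<close>

definition pos_form ::
  "(complex^'n) set \<Rightarrow> (complex^'n \<Rightarrow> complex^'n \<Rightarrow> complex^'n \<Rightarrow> complex^'n \<Rightarrow> complex) \<Rightarrow> bool" where
  "pos_form S B \<longleftrightarrow> (\<forall>(m::nat) ws xis. (\<forall>j<m. ws j \<in> S) \<longrightarrow>
     (\<Sum>i<m. \<Sum>j<m. B (ws i) (ws j) (xis j) (xis i)) \<in> \<real>\<^sub>\<ge>\<^sub>0)"

text \<open>The families used below are indexed by products and disjoint unions, so initial segments
  of the naturals are traded for arbitrary finite index sets.\<close>

lemma pos_formD:
  assumes "pos_form S B" "finite I" "\<And>i. i \<in> I \<Longrightarrow> w i \<in> S"
  shows "(\<Sum>i\<in>I. \<Sum>j\<in>I. B (w i) (w j) (\<xi> j) (\<xi> i)) \<in> \<real>\<^sub>\<ge>\<^sub>0"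
proof -
  obtain h where h: "bij_betw h {0..<card I} I"
    using ex_bij_betw_nat_finite[OF assms(2)] by blast
  then have h: "bij_betw h {..<card I} I" by (simp add: atLeast0LessThan)
  have "(\<Sum>i\<in>I. \<Sum>j\<in>I. B (w i) (w j) (\<xi> j) (\<xi> i)) =
    (\<Sum>i<card I. \<Sum>j<card I. B (w (h i)) (w (h j)) (\<xi> (h j)) (\<xi> (h i)))"
    by (simp add: sum.reindex_bij_betw[OF h, symmetric])
  moreover have "\<forall>j<card I. (w \<circ> h) j \<in> S"
    using h assms(3) by (auto simp: bij_betw_def)
  ultimately show ?thesis
    using assms(1)[unfolded pos_form_def, rule_format, of "card I" "w \<circ> h" "\<xi> \<circ> h"] by simp
qed

lemma nonneg_Reals_sum: "(\<And>i. i \<in> A \<Longrightarrow> f i \<in> \<real>\<^sub>\<ge>\<^sub>0) \<Longrightarrow> sum f A \<in> \<real>\<^sub>\<ge>\<^sub>0"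
  by (induction A rule: infinite_finite_induct) auto

lemma mult_cnj_nonneg_Reals: "x * cnj x \<in> \<real>\<^sub>\<ge>\<^sub>0"
  by (simp add: complex_mult_cnj complex_nonneg_Reals_iff)

text \<open>\<open>\<phi>\<close> acts as a feature map: interchanging sums turns the Gram sum into
  a sum over \<open>t\<close> of squared moduli of
  \<open>\<Sum>j<m. \<phi> t (ws j) (xis j)\<close>.\<close>

lemma pos_form_sum_squares:
  assumes "\<And>z w \<xi> \<eta>. B z w \<xi> \<eta> = (\<Sum>t\<in>T. \<phi> t w \<xi> * cnj (\<phi> t z \<eta>))"
  shows "pos_form S B"
  unfolding pos_form_def
proof (intro allI impI)
  fix m :: nat and ws xis
  have "(\<Sum>i<m. \<Sum>j<m. B (ws i) (ws j) (xis j) (xis i)) =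
    (\<Sum>i<m. \<Sum>t\<in>T. \<Sum>j<m. \<phi> t (ws j) (xis j) * cnj (\<phi> t (ws i) (xis i)))"
    unfolding assms by (intro sum.cong refl, rule sum.swap)
  also have "\<dots> = (\<Sum>t\<in>T. \<Sum>i<m. \<Sum>j<m. \<phi> t (ws j) (xis j) * cnj (\<phi> t (ws i) (xis i)))"
    by (rule sum.swap)
  also have "\<dots> = (\<Sum>t\<in>T. (\<Sum>j<m. \<phi> t (ws j) (xis j)) * cnj (\<Sum>j<m. \<phi> t (ws j) (xis j)))"
    unfolding cnj_sum sum_product by (rule sum.cong[OF refl], rule sum.swap)
  also have "\<dots> \<in> \<real>\<^sub>\<ge>\<^sub>0" by (intro nonneg_Reals_sum mult_cnj_nonneg_Reals)
  finally show "(\<Sum>i<m. \<Sum>j<m. B (ws i) (ws j) (xis j) (xis i)) \<in> \<real>\<^sub>\<ge>\<^sub>0" .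
qed

lemma pos_form_lincomb:
  assumes "pos_form S B" "pos_form S B'" "c \<in> \<real>\<^sub>\<ge>\<^sub>0" "c' \<in> \<real>\<^sub>\<ge>\<^sub>0"
  shows "pos_form S (\<lambda>z w \<xi> \<eta>. c * B z w \<xi> \<eta> + c' * B' z w \<xi> \<eta>)"
  using assms unfolding pos_form_def
  by (auto simp: sum.distrib sum_distrib_left[symmetric])

text \<open>The homogeneous part of degree \<open>l\<close> of the kernel, as a sesquilinear form in \<open>\<xi>\<close> and \<open>\<eta>\<close>.
  For \<open>l = 0\<close> the exponent \<open>l - 1\<close> is truncated, so \<open>p = 0\<close> is assumed there.\<close>

definition hform :: "nat \<Rightarrow> complex \<Rightarrow> complex \<Rightarrow> complex^'n \<Rightarrow> complex^'n \<Rightarrow> complex^'n \<Rightarrow> complex^'n \<Rightarrow> complex" where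
  "hform l p q z w \<xi> \<eta> =
     p * cinner z w ^ (l - 1) * (cinner z \<eta> * cinner \<xi> w) + q * cinner z w ^ l * cinner \<xi> \<eta>"

section \<open>Inner products of tensors in coordinates\<close>

lemma sum_of_bool_eq:
  fixes f :: "'a::finite \<Rightarrow> 'b::semiring_1"
  shows "(\<Sum>y\<in>UNIV. of_bool (y = k) * f y) = f k"
  by (subst sum.remove[of _ k]) (auto intro!: sum.neutral)

text \<open>Expanding the power by distributivity gives one term for each choice \<open>t\<close> of
  a coordinate per slot, so both sides are the inner product of two pure tensor powers.\<close>

lemma sum_tensor_power:
  fixes z w :: "complex^'n"
  assumes "finite J"
  shows "(\<Sum>t\<in>J \<rightarrow>\<^sub>E UNIV. (\<Prod>j\<in>J. z $ t j) * cnj (\<Prod>j\<in>J. w $ t j)) = cinner z w ^ card J"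
proof -
  have "cinner z w ^ card J = (\<Prod>j\<in>J. \<Sum>y\<in>UNIV. z $ y * cnj (w $ y))"
    by (simp add: cinner_def)
  also have "\<dots> = (\<Sum>t\<in>J \<rightarrow>\<^sub>E UNIV. \<Prod>j\<in>J. z $ t j * cnj (w $ t j))"
    using assms by (subst prod_sum_PiE) auto
  finally show ?thesis by (simp add: prod.distrib)
qed

text \<open>The second tensor has the basis vector of index \<open>k\<close> in slot
  \<open>m\<close>. Inner products of pure tensors factor over the slots, and slot \<open>m\<close>
  contributes \<open>z $ k\<close>.\<close>

lemma sum_tensor_power_del:
  fixes z w :: "complex^'n"
  assumes "finite J" "m \<in> J"
  shows "(\<Sum>t\<in>J \<rightarrow>\<^sub>E UNIV. of_bool (t m = k) * ((\<Prod>j\<in>J. z $ t j) * cnj (\<Prod>j\<in>J-{m}. w $ t j)))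
    = z $ k * cinner z w ^ (card J - 1)"
proof -
  define g where "g j y = (if j = m then of_bool (y = k) * z $ y else z $ y * cnj (w $ y))" for j y
  have "(\<Sum>t\<in>J \<rightarrow>\<^sub>E UNIV. \<Prod>j\<in>J. g j (t j)) = (\<Prod>j\<in>J. \<Sum>y\<in>UNIV. g j y)"
    using assms by (subst prod_sum_PiE) auto
  also have "\<dots> = (\<Sum>y\<in>UNIV. g m y) * (\<Prod>j\<in>J-{m}. \<Sum>y\<in>UNIV. g j y)"
    using assms by (simp add: prod.remove)
  also have "(\<Sum>y\<in>UNIV. g m y) = z $ k"
    by (simp add: g_def sum_of_bool_eq)
  also have "(\<Prod>j\<in>J-{m}. \<Sum>y\<in>UNIV. g j y) = (\<Prod>j\<in>J-{m}. cinner z w)"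
    by (intro prod.cong refl) (auto simp: g_def cinner_def)
  also have "\<dots> = cinner z w ^ (card J - 1)"
    using assms by simp
  also have "(\<Sum>t\<in>J \<rightarrow>\<^sub>E UNIV. \<Prod>j\<in>J. g j (t j)) =
    (\<Sum>t\<in>J \<rightarrow>\<^sub>E UNIV. of_bool (t m = k) * ((\<Prod>j\<in>J. z $ t j) * cnj (\<Prod>j\<in>J-{m}. w $ t j)))"
  proof (intro sum.cong refl)
    fix t
    have "(\<Prod>j\<in>J. g j (t j)) = g m (t m) * (\<Prod>j\<in>J-{m}. g j (t j))"
      using assms by (simp add: prod.remove)
    also have "(\<Prod>j\<in>J-{m}. g j (t j)) = (\<Prod>j\<in>J-{m}. z $ t j * cnj (w $ t j))"
      by (intro prod.cong refl) (auto simp: g_def)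
    also have "(\<Prod>j\<in>J. z $ t j) = z $ t m * (\<Prod>j\<in>J-{m}. z $ t j)"
      using assms by (simp add: prod.remove)
    ultimately show "(\<Prod>j\<in>J. g j (t j)) =
      of_bool (t m = k) * ((\<Prod>j\<in>J. z $ t j) * cnj (\<Prod>j\<in>J-{m}. w $ t j))"
      by (simp add: g_def prod.distrib mult_ac prod.remove[OF assms])
  qed
  finally show ?thesis .
qed

text \<open>Both tensors carry the basis vector of index \<open>k\<close>, in slots \<open>m\<close>
  and \<open>m'\<close>. If the slots agree, the sum over \<open>k\<close> is the trace of the
  identity; otherwise they contribute \<open>cnj (w $ k)\<close> and \<open>z $ k\<close>, whose
  product sums to one more factor \<open>cinner z w\<close>.\<close>

lemma sum_tensor_power_del2:
  fixes z w :: "complex^'n"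
  assumes "finite J" "m \<in> J" "m' \<in> J"
  shows "(\<Sum>k\<in>UNIV. \<Sum>t\<in>J \<rightarrow>\<^sub>E UNIV. of_bool (t m = k) * of_bool (t m' = k) *
      ((\<Prod>j\<in>J-{m}. z $ t j) * cnj (\<Prod>j\<in>J-{m'}. w $ t j)))
    = (if m = m' then of_nat CARD('n) else 1) * cinner z w ^ (card J - 1)"
proof (cases "m = m'")
  case True
  define g where "g j y = (if j = m then 1 else z $ y * cnj (w $ y))" for j y
  have "(\<Sum>k\<in>UNIV. \<Sum>t\<in>J \<rightarrow>\<^sub>E UNIV. of_bool (t m = k) * of_bool (t m' = k) *
      ((\<Prod>j\<in>J-{m}. z $ t j) * cnj (\<Prod>j\<in>J-{m'}. w $ t j))) =
    (\<Sum>t\<in>J \<rightarrow>\<^sub>E UNIV. \<Sum>k\<in>UNIV. of_bool (t m = k) * ((\<Prod>j\<in>J-{m}. z $ t j) * cnj (\<Prod>j\<in>J-{m}. w $ t j)))"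
    using True by (subst sum.swap) (auto intro!: sum.cong)
  also have "\<dots> = (\<Sum>t\<in>J \<rightarrow>\<^sub>E UNIV. (\<Prod>j\<in>J-{m}. z $ t j) * cnj (\<Prod>j\<in>J-{m}. w $ t j))"
    by (simp add: sum_distrib_right[symmetric] of_bool_def)
  also have "\<dots> = (\<Sum>t\<in>J \<rightarrow>\<^sub>E UNIV. \<Prod>j\<in>J. g j (t j))"
  proof (intro sum.cong refl)
    fix t
    have "(\<Prod>j\<in>J. g j (t j)) = g m (t m) * (\<Prod>j\<in>J-{m}. g j (t j))"
      using assms by (simp add: prod.remove)
    also have "(\<Prod>j\<in>J-{m}. g j (t j)) = (\<Prod>j\<in>J-{m}. z $ t j * cnj (w $ t j))"
      by (intro prod.cong refl) (auto simp: g_def)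
    finally show "(\<Prod>j\<in>J-{m}. z $ t j) * cnj (\<Prod>j\<in>J-{m}. w $ t j) = (\<Prod>j\<in>J. g j (t j))"
      by (simp add: g_def prod.distrib)
  qed
  also have "\<dots> = (\<Prod>j\<in>J. \<Sum>y\<in>UNIV. g j y)"
    using assms by (subst prod_sum_PiE) auto
  also have "\<dots> = (\<Sum>y\<in>UNIV. g m y) * (\<Prod>j\<in>J-{m}. \<Sum>y\<in>UNIV. g j y)"
    using assms by (simp add: prod.remove)
  also have "(\<Prod>j\<in>J-{m}. \<Sum>y\<in>UNIV. g j y) = (\<Prod>j\<in>J-{m}. cinner z w)"
    by (intro prod.cong refl) (auto simp: g_def cinner_def)
  finally show ?thesis using True assms by (simp add: g_def)
next
  case False
  define g where "g k j y = (if j = m then of_bool (y = k) * cnj (w $ y)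
    else if j = m' then of_bool (y = k) * z $ y else z $ y * cnj (w $ y))" for k j y
  have m': "m' \<in> J - {m}" "m \<in> J - {m'}" using assms False by auto
  have eq: "J - {m'} - {m} = J - {m} - {m'}" by auto
  have "(\<Sum>t\<in>J \<rightarrow>\<^sub>E UNIV. of_bool (t m = k) * of_bool (t m' = k) *
      ((\<Prod>j\<in>J-{m}. z $ t j) * cnj (\<Prod>j\<in>J-{m'}. w $ t j)))
      = z $ k * cnj (w $ k) * cinner z w ^ (card J - 2)" for k
  proof -
    have "(\<Sum>t\<in>J \<rightarrow>\<^sub>E UNIV. of_bool (t m = k) * of_bool (t m' = k) *
      ((\<Prod>j\<in>J-{m}. z $ t j) * cnj (\<Prod>j\<in>J-{m'}. w $ t j))) =
      (\<Sum>t\<in>J \<rightarrow>\<^sub>E UNIV. \<Prod>j\<in>J. g k j (t j))"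
    proof (intro sum.cong refl)
      fix t
      have "(\<Prod>j\<in>J. g k j (t j)) = g k m (t m) * (g k m' (t m') * (\<Prod>j\<in>J-{m}-{m'}. g k j (t j)))"
        using assms m' by (simp add: prod.remove)
      also have "(\<Prod>j\<in>J-{m}-{m'}. g k j (t j)) = (\<Prod>j\<in>J-{m}-{m'}. z $ t j * cnj (w $ t j))"
        by (intro prod.cong refl) (auto simp: g_def)
      finally show "of_bool (t m = k) * of_bool (t m' = k) *
          ((\<Prod>j\<in>J-{m}. z $ t j) * cnj (\<Prod>j\<in>J-{m'}. w $ t j)) = (\<Prod>j\<in>J. g k j (t j))"
        using False assms m' eq
        by (simp add: g_def prod.distrib prod.remove[OF _ m'(1)] prod.remove[OF _ m'(2)] mult_ac)
    qed
    also have "\<dots> = (\<Prod>j\<in>J. \<Sum>y\<in>UNIV. g k j y)"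
      using assms by (subst prod_sum_PiE) auto
    also have "\<dots> = (\<Sum>y\<in>UNIV. g k m y) * ((\<Sum>y\<in>UNIV. g k m' y) * (\<Prod>j\<in>J-{m}-{m'}. \<Sum>y\<in>UNIV. g k j y))"
      using assms m' by (simp add: prod.remove)
    also have "(\<Prod>j\<in>J-{m}-{m'}. \<Sum>y\<in>UNIV. g k j y) = (\<Prod>j\<in>J-{m}-{m'}. cinner z w)"
      by (intro prod.cong refl) (auto simp: g_def cinner_def)
    also have "(\<Sum>y\<in>UNIV. g k m y) = cnj (w $ k)"
      by (simp add: g_def sum_of_bool_eq)
    also have "(\<Sum>y\<in>UNIV. g k m' y) = z $ k"
      using False by (simp add: g_def sum_of_bool_eq)
    finally show ?thesis using assms m' by (simp add: mult_ac numeral_2_eq_2)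
  qed
  then have "(\<Sum>k\<in>UNIV. \<Sum>t\<in>J \<rightarrow>\<^sub>E UNIV. of_bool (t m = k) * of_bool (t m' = k) *
      ((\<Prod>j\<in>J-{m}. z $ t j) * cnj (\<Prod>j\<in>J-{m'}. w $ t j))) = cinner z w * cinner z w ^ (card J - 2)"
    by (simp add: sum_distrib_right[symmetric] cinner_def)
  also have "\<dots> = cinner z w ^ (card J - 1)"
  proof -
    have "card {m, m'} \<le> card J" using assms by (intro card_mono) auto
    then have "card J - 1 = Suc (card J - 2)" using False by simp
    then show ?thesis by simp
  qed
  finally show ?thesis using False by simp
qed

text \<open>The feature map is the tensor power with \<open>l - 1\<close> slots times the scalar
  \<open>cinner \<xi> w\<close>.\<close>

lemma pos_form_hform_1_0: "pos_form S (hform l 1 0)"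
proof (rule pos_form_sum_squares)
  fix z w \<xi> \<eta> :: "complex^'n"
  show "hform l 1 0 z w \<xi> \<eta> = (\<Sum>t\<in>{..<l-1} \<rightarrow>\<^sub>E UNIV.
      (cinner \<xi> w * cnj (\<Prod>j<l-1. w $ t j)) * cnj (cinner \<eta> z * cnj (\<Prod>j<l-1. z $ t j)))"
    unfolding hform_def
    using sum_tensor_power[of "{..<l-1}" z w]
    by (simp add: cnj_cinner sum_distrib_left[symmetric] mult_ac)
qed

text \<open>The squared norm of the tensor \<open>w\<^sup>l \<otimes> \<xi>\<close> after subtracting its projection onto the tensors
  that insert the identity matrix into one of the \<open>l\<close> slots and \<open>\<xi>\<close>.\<close>

lemma pos_form_hform_divergence_free:
  assumes "l \<ge> 1"
  shows "pos_form S (hform l (- of_nat l / of_nat (l + CARD('n) - 1)) 1 ::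
    complex^'n \<Rightarrow> complex^'n \<Rightarrow> complex^'n \<Rightarrow> complex^'n \<Rightarrow> complex)"
proof (rule pos_form_sum_squares)
  fix z w \<xi> \<eta> :: "complex^'n"
  define N where "N = l + CARD('n) - 1"
  define c :: complex where "c = 1 / of_nat N"
  have N: "N > 0" using assms zero_less_card_finite[where 'a='n] unfolding N_def by linarith
  define J where "J = {..<l}"
  have J: "finite J" "card J = l" by (auto simp: J_def)
  define P where "P t v = (\<Prod>j\<in>J. v $ t j)" for t and v :: "complex^'n"
  define R where "R t q v = (\<Sum>m\<in>J. of_bool (t m = q) * (\<Prod>j\<in>J-{m}. v $ t j))"
    for t q and v :: "complex^'n"
  \<comment> \<open>\<open>P\<close> and \<open>R\<close> are the coordinates of the pure power and
    of the sum of the identity insertions over all slots. By \<open>PR\<close> the adjoint of the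
    insertion yields a factor \<open>of_nat l\<close>, and by \<open>RR\<close> the insertion scales
    inner products by \<open>of_nat l * of_nat N\<close>; hence the projection has coefficient
    \<open>c = 1 / of_nat N\<close>.\<close>
  define \<phi> where "\<phi> = (\<lambda>(t, q) v \<zeta>. cnj (P t v) * \<zeta> $ q - c * cnj (R t q v) * cinner \<zeta> v)"
  have cnj_of_bool: "cnj (of_bool b) = of_bool b" for b by (cases b) auto
  let ?T = "J \<rightarrow>\<^sub>E (UNIV::'n set)"
  let ?s = "cinner z w"
  have PP: "(\<Sum>t\<in>?T. P t z * cnj (P t w)) = ?s ^ l"
    using sum_tensor_power[OF J(1), of z w] J by (simp add: P_def)
  have PR: "(\<Sum>t\<in>?T. P t z * cnj (R t q w)) = of_nat l * (z $ q * cinner z w ^ (l - 1))" for q and z w :: "complex^'n"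
  proof -
    have "(\<Sum>t\<in>?T. P t z * cnj (R t q w)) =
      (\<Sum>t\<in>?T. \<Sum>m\<in>J. of_bool (t m = q) * ((\<Prod>j\<in>J. z $ t j) * cnj (\<Prod>j\<in>J-{m}. w $ t j)))"
      by (simp add: P_def R_def sum_distrib_left cnj_of_bool mult_ac)
    also have "\<dots> = (\<Sum>m\<in>J. z $ q * cinner z w ^ (card J - 1))"
      by (subst sum.swap) (simp add: sum_tensor_power_del J del: cnj_prod)
    finally show ?thesis using J by simp
  qed
  have RR: "(\<Sum>q\<in>UNIV. \<Sum>t\<in>?T. R t q z * cnj (R t q w)) = of_nat l * of_nat N * ?s ^ (l - 1)"
  proof -
    have "(\<Sum>q\<in>UNIV. \<Sum>t\<in>?T. R t q z * cnj (R t q w)) =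
      (\<Sum>q\<in>UNIV. \<Sum>t\<in>?T. \<Sum>m\<in>J. \<Sum>m'\<in>J. of_bool (t m = q) * of_bool (t m' = q) *
        ((\<Prod>j\<in>J-{m}. z $ t j) * cnj (\<Prod>j\<in>J-{m'}. w $ t j)))"
      by (simp add: R_def sum_product cnj_of_bool mult_ac)
    also have "\<dots> = (\<Sum>q\<in>UNIV. \<Sum>m\<in>J. \<Sum>m'\<in>J. \<Sum>t\<in>?T. of_bool (t m = q) * of_bool (t m' = q) *
        ((\<Prod>j\<in>J-{m}. z $ t j) * cnj (\<Prod>j\<in>J-{m'}. w $ t j)))"
      by (subst sum.swap) (subst (2) sum.swap, rule refl)
    also have "\<dots> = (\<Sum>m\<in>J. \<Sum>m'\<in>J. \<Sum>q\<in>UNIV. \<Sum>t\<in>?T. of_bool (t m = q) * of_bool (t m' = q) *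
        ((\<Prod>j\<in>J-{m}. z $ t j) * cnj (\<Prod>j\<in>J-{m'}. w $ t j)))"
      by (subst sum.swap) (subst (2) sum.swap, rule refl)
    also have "\<dots> = (\<Sum>m\<in>J. \<Sum>m'\<in>J. (if m = m' then of_nat CARD('n) else 1) * cinner z w ^ (card J - 1))"
      by (intro sum.cong refl sum_tensor_power_del2 J)
    also have "\<dots> = (\<Sum>m\<in>J. (\<Sum>m'\<in>J. (if m = m' then of_nat CARD('n) else 1)) * cinner z w ^ (card J - 1))"
      by (simp add: sum_distrib_right)
    \<comment> \<open>Each row has one diagonal entry \<open>CARD('n)\<close> and
      \<open>l - 1\<close> entries 1, which is where \<open>N\<close> comes from.\<close>
    also have "\<dots> = (\<Sum>m\<in>J. of_nat N * cinner z w ^ (card J - 1))"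
    proof (intro sum.cong refl)
      fix m assume "m \<in> J"
      have "(\<Sum>m'\<in>J. (if m = m' then of_nat CARD('n) else 1)) =
        of_nat CARD('n) + (\<Sum>m'\<in>J-{m}. (if m = m' then of_nat CARD('n) else (1::complex)))"
        using J \<open>m \<in> J\<close> by (simp add: sum.remove)
      also have "(\<Sum>m'\<in>J-{m}. (if m = m' then of_nat CARD('n) else (1::complex))) = (\<Sum>m'\<in>J-{m}. 1)"
        by (intro sum.cong) auto
      also have "of_nat CARD('n) + \<dots> = (of_nat N :: complex)"
        using J \<open>m \<in> J\<close> assms by (simp add: N_def of_nat_diff)
      finally show "(\<Sum>m'\<in>J. (if m = m' then of_nat CARD('n) else 1)) * cinner z w ^ (card J - 1) =
        of_nat N * cinner z w ^ (card J - 1)" by simp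
    qed
    finally show ?thesis using J by simp
  qed
  have "(\<Sum>x\<in>?T \<times> UNIV. \<phi> x w \<xi> * cnj (\<phi> x z \<eta>)) =
    (\<Sum>q\<in>UNIV. \<Sum>t\<in>?T. (cnj (P t w) * \<xi> $ q - c * cnj (R t q w) * cinner \<xi> w) *
       (P t z * cnj (\<eta> $ q) - c * R t q z * cinner z \<eta>))"
    by (subst sum.swap) (simp add: sum.cartesian_product \<phi>_def case_prod_unfold cnj_cinner c_def)
  also have "\<dots> = (\<Sum>q\<in>UNIV. \<Sum>t\<in>?T. (\<xi> $ q * cnj (\<eta> $ q)) * (P t z * cnj (P t w))
      - c * cinner \<xi> w * cnj (\<eta> $ q) * (P t z * cnj (R t q w))
      - c * cinner z \<eta> * \<xi> $ q * cnj (P t w * cnj (R t q z))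
      + c * c * cinner \<xi> w * cinner z \<eta> * (R t q z * cnj (R t q w)))"
    by (intro sum.cong refl) (simp add: algebra_simps)
  also have "\<dots> = (\<Sum>q\<in>UNIV. \<xi> $ q * cnj (\<eta> $ q) * (\<Sum>t\<in>?T. P t z * cnj (P t w)))
      - c * cinner \<xi> w * (\<Sum>q\<in>UNIV. cnj (\<eta> $ q) * (\<Sum>t\<in>?T. P t z * cnj (R t q w)))
      - c * cinner z \<eta> * (\<Sum>q\<in>UNIV. \<xi> $ q * cnj (\<Sum>t\<in>?T. P t w * cnj (R t q z)))
      + c * c * cinner \<xi> w * cinner z \<eta> * (\<Sum>q\<in>UNIV. \<Sum>t\<in>?T. R t q z * cnj (R t q w))"
    by (simp add: sum.distrib sum_subtractf sum_distrib_left mult_ac)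
  also have "\<dots> = (\<Sum>q\<in>UNIV. \<xi> $ q * cnj (\<eta> $ q)) * ?s ^ l
      - c * cinner \<xi> w * (\<Sum>q\<in>UNIV. cnj (\<eta> $ q) * (of_nat l * (z $ q * ?s ^ (l - 1))))
      - c * cinner z \<eta> * (\<Sum>q\<in>UNIV. \<xi> $ q * cnj (of_nat l * (w $ q * cinner w z ^ (l - 1))))
      + c * c * cinner \<xi> w * cinner z \<eta> * (of_nat l * of_nat N * ?s ^ (l - 1))"
    unfolding PP PR RR sum_distrib_right by (rule refl)
  also have "(\<Sum>q\<in>UNIV. cnj (\<eta> $ q) * (of_nat l * (z $ q * ?s ^ (l - 1)))) = of_nat l * ?s ^ (l - 1) * cinner z \<eta>"
    by (simp add: cinner_def[of z \<eta>] sum_distrib_left mult_ac)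
  also have "(\<Sum>q\<in>UNIV. \<xi> $ q * cnj (of_nat l * (w $ q * cinner w z ^ (l - 1)))) = of_nat l * ?s ^ (l - 1) * cinner \<xi> w"
    by (simp add: cinner_def[of \<xi> w] cnj_cinner sum_distrib_left mult_ac)
  also have "(\<Sum>q\<in>UNIV. \<xi> $ q * cnj (\<eta> $ q)) = cinner \<xi> \<eta>"
    by (simp add: cinner_def)
  \<comment> \<open>Since \<open>c * of_nat N = 1\<close>, the quadratic term cancels one of the two
    equal cross terms, as for any orthogonal projection.\<close>
  also have "c * c * cinner \<xi> w * cinner z \<eta> * (of_nat l * of_nat N * ?s ^ (l - 1)) =
      c * cinner \<xi> w * cinner z \<eta> * of_nat l * ?s ^ (l - 1)"
    using N by (simp add: c_def)
  also have "cinner \<xi> \<eta> * ?s ^ l - c * cinner \<xi> w * (of_nat l * ?s ^ (l - 1) * cinner z \<eta>) -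
      c * cinner z \<eta> * (of_nat l * ?s ^ (l - 1) * cinner \<xi> w) +
      c * cinner \<xi> w * cinner z \<eta> * of_nat l * ?s ^ (l - 1) =
      hform l (- of_nat l / of_nat (l + CARD('n) - 1)) 1 z w \<xi> \<eta>"
    unfolding N_def[symmetric] hform_def c_def by (simp add: mult_ac)
  finally show "hform l (- of_nat l / of_nat (l + CARD('n) - 1)) 1 z w \<xi> \<eta> =
    (\<Sum>x\<in>?T \<times> UNIV. \<phi> x w \<xi> * cnj (\<phi> x z \<eta>))" by simp
qed

text \<open>With \<open>N = l + CARD('n) - 1\<close> the form is \<open>(N * p + l * q) / N\<close>
  times \<open>hform l 1 0\<close> plus \<open>q\<close> times the divergence-free form, and the
  hypotheses make both weights nonnegative. For \<open>l = 0\<close> only a multiple of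
  \<open>cinner \<xi> \<eta>\<close> remains.\<close>

lemma pos_form_hform:
  assumes "q \<in> \<real>\<^sub>\<ge>\<^sub>0" "of_nat (l + CARD('n) - 1) * p + of_nat l * q \<in> \<real>\<^sub>\<ge>\<^sub>0" "l = 0 \<Longrightarrow> p = 0"
  shows "pos_form S (hform l p q ::
    complex^'n \<Rightarrow> complex^'n \<Rightarrow> complex^'n \<Rightarrow> complex^'n \<Rightarrow> complex)"
proof (cases "l = 0")
  case True
  have "pos_form S (\<lambda>z w \<xi> \<eta>::complex^'n. q * cinner \<xi> \<eta>)"
  proof -
    have "pos_form S (\<lambda>z w \<xi> \<eta>::complex^'n. cinner \<xi> \<eta>)"
      by (rule pos_form_sum_squares[where T = UNIV and \<phi> = "\<lambda>k w \<xi>. \<xi> $ k"]) (simp add: cinner_def)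
    from pos_form_lincomb[OF this this assms(1), of 0] show ?thesis by simp
  qed
  also have "(\<lambda>z w \<xi> \<eta>. q * cinner \<xi> \<eta>) = hform l p q"
    using True assms(3) by (auto simp: hform_def fun_eq_iff)
  finally show ?thesis .
next
  case False
  define N where "N = l + CARD('n) - 1"
  have N: "N > 0" using False zero_less_card_finite[where 'a='n] unfolding N_def by linarith
  have "pos_form S (\<lambda>z w \<xi> \<eta>::complex^'n. ((of_nat N * p + of_nat l * q) / of_nat N) * hform l 1 0 z w \<xi> \<eta>
     + q * hform l (- of_nat l / of_nat N) 1 z w \<xi> \<eta>)"
    unfolding N_def using assms False
    by (intro pos_form_lincomb pos_form_hform_1_0 pos_form_hform_divergence_free nonneg_Reals_divide_I nonneg_Reals_of_nat_I) auto
  also have "(\<lambda>z w \<xi> \<eta>::complex^'n. ((of_nat N * p + of_nat l * q) / of_nat N) * hform l 1 0 z w \<xi> \<eta>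
     + q * hform l (- of_nat l / of_nat N) 1 z w \<xi> \<eta>) = hform l p q"
    using N by (simp add: hform_def fun_eq_iff field_simps)
  finally show ?thesis .
qed

section \<open>Averages over roots of unity\<close>

definition unity_root :: "nat \<Rightarrow> nat \<Rightarrow> complex" where
  "unity_root N j = cis (2 * pi * real j / real N)"

lemma norm_unity_root [simp]: "norm (unity_root N j) = 1"
  by (simp add: unity_root_def)

lemma unity_root_mult_cnj [simp]: "unity_root N j * cnj (unity_root N j) = 1"
  by (simp add: unity_root_def cis_cnj cis_mult)

lemma unity_root_power: "N > 0 \<Longrightarrow> unity_root N j ^ N = 1"
  by (simp add: unity_root_def Complex.DeMoivre)

text \<open>Orthogonality of characters: for \<open>e \<noteq> k\<close> the summands are the powers
  \<open>x ^ j\<close> of one root of unity \<open>x\<close>, which is not 1 because roots with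
  distinct indices below \<open>N\<close> differ. The geometric sum then vanishes.\<close>

lemma sum_unity_root_powers:
  assumes "e < N" "k < N"
  shows "(\<Sum>j<N. unity_root N j ^ e * cnj (unity_root N j) ^ k) = (if e = k then of_nat N else 0)"
proof (cases "e = k")
  case True
  then show ?thesis by (simp add: power_mult_distrib[symmetric])
next
  case False
  define x where "x = unity_root N e * cnj (unity_root N k)"
  have N: "N > 0" using assms by simp
  have pw: "unity_root N j ^ e * cnj (unity_root N j) ^ k = x ^ j" for j
    unfolding x_def unity_root_def cis_cnj Complex.DeMoivre cis_mult
    by (rule arg_cong[where f = cis]) (simp add: field_simps)
  have "x \<noteq> 1"
  proof
    assume "x = 1"
    then have "unity_root N e = unity_root N k * x"
      by (metis (no_types, lifting) mult.commute mult.left_commute mult.right_neutral unity_root_mult_cnj x_def)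
    then have "unity_root N e = unity_root N k" using \<open>x = 1\<close> by simp
    moreover have "inj_on (unity_root N) {..<N}"
      using Complex.bij_betw_roots_unity[OF N] by (simp add: bij_betw_def unity_root_def[abs_def])
    ultimately show False using assms False by (auto simp: inj_on_def)
  qed
  moreover have "x ^ N = 1"
    using N by (simp add: x_def power_mult_distrib unity_root_power flip: complex_cnj_power)
  ultimately show ?thesis using False by (simp add: pw geometric_sum)
qed

text \<open>Fourier extraction of the term with \<open>b ^ e\<close> from the binomial expansion;
  \<open>p < N\<close> keeps the exponents distinguishable.\<close>

lemma sum_unity_root_binomial:
  assumes "p < N" "e \<le> p"
  shows "(\<Sum>j<N. unity_root N j ^ e * (a + cnj (unity_root N j) * b) ^ p) =
    of_nat N * of_nat (p choose e) * b ^ e * a ^ (p - e)"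
proof -
  let ?u = "unity_root N"
  have "(\<Sum>j<N. ?u j ^ e * (a + cnj (?u j) * b) ^ p) =
     (\<Sum>j<N. \<Sum>k\<le>p. of_nat (p choose k) * b ^ k * a ^ (p - k) * (?u j ^ e * cnj (?u j) ^ k))"
    by (subst add.commute, subst binomial_ring)
      (simp add: sum_distrib_left power_mult_distrib mult_ac)
  also have "\<dots> = (\<Sum>k\<le>p. of_nat (p choose k) * b ^ k * a ^ (p - k) * (\<Sum>j<N. ?u j ^ e * cnj (?u j) ^ k))"
    by (subst sum.swap) (simp add: sum_distrib_left)
  also have "\<dots> = (\<Sum>k\<le>p. if k = e then of_nat (p choose k) * b ^ k * a ^ (p - k) * of_nat N else 0)"
    using assms by (intro sum.cong refl) (auto simp: sum_unity_root_powers)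
  also have "\<dots> = of_nat N * of_nat (p choose e) * b ^ e * a ^ (p - e)"
    using assms by (simp add: mult_ac)
  finally show ?thesis .
qed

text \<open>A single basis vector as point and an orthogonal one as vector annihilate the
  \<open>p\<close>-term and leave \<open>q\<close>; two dimensions make this choice
  possible.\<close>

lemma pos_form_hformD_snd:
  assumes "CARD('n) \<ge> 2"
    and pos: "pos_form UNIV (hform l p q :: complex^'n \<Rightarrow> complex^'n \<Rightarrow> complex^'n \<Rightarrow> complex^'n \<Rightarrow> complex)"
  shows "q \<in> \<real>\<^sub>\<ge>\<^sub>0"
proof -
  obtain k k' :: 'n where k: "k \<noteq> k'"
    using assms(1) by (metis card_2_iff' ex_card UNIV_I)
  have "hform l p q (axis k 1 :: complex^'n) (axis k 1) (axis k' 1) (axis k' 1) \<in> \<real>\<^sub>\<ge>\<^sub>0"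
    using pos_formD[OF pos, of "{0::nat}" "\<lambda>_. axis k 1" "\<lambda>_. axis k' 1"] by simp
  moreover have "axis k' (1::complex) $ k = 0" using k by (simp add: axis_def)
  ultimately show ?thesis by (simp add: hform_def cinner_axis_left)
qed

text \<open>The family in the proof is chosen such that the corresponding combination of the functions
  \<open>z \<mapsto> \<langle>z, w\<rangle>\<^sup>l \<xi>\<close> is a multiple of \<open>z\<close>, namely \<open>z\<close> times the power \<open>l - 1\<close> of the coordinate \<open>z $ k\<close>.\<close>

lemma pos_form_hformD_fst:
  assumes l: "l \<ge> 1"
    and pos: "pos_form UNIV (hform l p q :: complex^'n \<Rightarrow> complex^'n \<Rightarrow> complex^'n \<Rightarrow> complex^'n \<Rightarrow> complex)"
  shows "of_nat (l + CARD('n) - 1) * p + of_nat l * q \<in> \<real>\<^sub>\<ge>\<^sub>0"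
proof -
  obtain k :: 'n where True by simp
  define N where "N = Suc l"
  define u where "u = unity_root N"
  \<comment> \<open>For \<open>r \<noteq> k\<close> the points run through roots of unity in
    direction \<open>r\<close>. The weights \<open>\<rho>\<close> select the term linear in
    \<open>z $ r\<close> of \<open>cinner z (w (r, j)) ^ l\<close> and cancel its factor
    \<open>of_nat N * of_nat l\<close>. \<open>N = Suc l\<close> exceeds all exponents.\<close>
  define w :: "'n \<times> nat \<Rightarrow> complex^'n" where
    "w = (\<lambda>(r, j). if r = k then axis k 1 else axis k 1 + axis r (u j))"
  define \<rho> :: "'n \<times> nat \<Rightarrow> complex" where
    "\<rho> = (\<lambda>(r, j). if r = k then 1 / of_nat N else u j / (of_nat N * of_nat l))"
  define \<xi> :: "'n \<times> nat \<Rightarrow> complex^'n" where "\<xi> x = axis (fst x) (\<rho> x)" for x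
  define \<gamma> :: complex where "\<gamma> = of_nat (l + CARD('n) - 1) / of_nat l"
  let ?I = "(UNIV :: 'n set) \<times> {..<N}"
  have l0: "of_nat l \<noteq> (0::complex)" using l by simp
  have N0: "of_nat N \<noteq> (0::complex)" unfolding N_def by (rule of_nat_neq_0)
  have sum_pair: "(\<Sum>x\<in>?I. f x) = (\<Sum>r\<in>UNIV. \<Sum>j<N. f (r, j))" for f :: "'n \<times> nat \<Rightarrow> complex"
    by (simp add: sum.cartesian_product)
  have cw: "cinner z (w (r, j)) = (if r = k then z $ k else z $ k + cnj (u j) * z $ r)" for z r j
    by (simp add: w_def cnj_cinner[of _ z, symmetric] cinner_add_left cinner_axis_left)
  have sum1: "(\<Sum>x\<in>?I. cinner z (w x) ^ l * cinner (\<xi> x) \<eta>) = (z $ k) ^ (l - 1) * cinner z \<eta>" for z \<eta>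
  proof -
    have "(\<Sum>j<N. cinner z (w (r, j)) ^ l * cinner (\<xi> (r, j)) \<eta>) = (z $ k) ^ (l - 1) * z $ r * cnj (\<eta> $ r)" for r
    proof (cases "r = k")
      case True
      have "(z $ k) ^ l = (z $ k) ^ (l - 1) * z $ k" using l by (metis power_minus_mult less_eq_Suc_le One_nat_def)
      then show ?thesis using True N0 by (simp add: cw \<xi>_def \<rho>_def cinner_axis_left)
    next
      case False
      have "(\<Sum>j<N. cinner z (w (r, j)) ^ l * cinner (\<xi> (r, j)) \<eta>) =
        (\<Sum>j<N. u j ^ 1 * (z $ k + cnj (u j) * z $ r) ^ l) * (cnj (\<eta> $ r) / (of_nat N * of_nat l))"
        using False by (simp add: cw \<xi>_def \<rho>_def cinner_axis_left sum_distrib_left sum_divide_distrib mult_ac)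
      also have "(\<Sum>j<N. u j ^ 1 * (z $ k + cnj (u j) * z $ r) ^ l) = of_nat N * of_nat (l choose 1) * (z $ r) ^ 1 * (z $ k) ^ (l - 1)"
        unfolding u_def using l by (intro sum_unity_root_binomial) (auto simp: N_def)
      finally show ?thesis using N0 l0 by (simp add: field_simps)
    qed
    then show ?thesis
      unfolding sum_pair cinner_def[of z \<eta>] by (simp add: sum_distrib_left mult_ac)
  qed
  have sum2: "(\<Sum>x\<in>?I. cinner z (w x) ^ (l - 1) * cinner (\<xi> x) (w x)) = \<gamma> * (z $ k) ^ (l - 1)" for z
  proof -
    have "(\<Sum>j<N. cinner z (w (r, j)) ^ (l - 1) * cinner (\<xi> (r, j)) (w (r, j))) =
      (z $ k) ^ (l - 1) * (if r = k then 1 else 1 / of_nat l)" for r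
    proof (cases "r = k")
      case True
      then show ?thesis using N0 by (simp add: cw \<xi>_def \<rho>_def cinner_axis_left)
    next
      case False
      have uu: "u j * cnj (u j) = 1" for j by (simp add: u_def)
      have "w (r, j) $ r = u j" for j using False by (simp add: w_def axis_def)
      then have "cinner (\<xi> (r, j)) (w (r, j)) = 1 / (of_nat N * of_nat l)" for j
        using False by (simp add: \<xi>_def \<rho>_def cinner_axis_left uu)
      then have "(\<Sum>j<N. cinner z (w (r, j)) ^ (l - 1) * cinner (\<xi> (r, j)) (w (r, j))) =
        (\<Sum>j<N. u j ^ 0 * (z $ k + cnj (u j) * z $ r) ^ (l - 1)) * (1 / (of_nat N * of_nat l))"
        using False by (simp add: cw sum_divide_distrib)
      also have "(\<Sum>j<N. u j ^ 0 * (z $ k + cnj (u j) * z $ r) ^ (l - 1)) =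
          of_nat N * of_nat ((l - 1) choose 0) * (z $ r) ^ 0 * (z $ k) ^ (l - 1 - 0)"
        unfolding u_def by (intro sum_unity_root_binomial) (auto simp: N_def)
      finally show ?thesis using N0 l0 False by (simp add: field_simps)
    qed
    then have "(\<Sum>x\<in>?I. cinner z (w x) ^ (l - 1) * cinner (\<xi> x) (w x)) =
      (z $ k) ^ (l - 1) * (\<Sum>r\<in>UNIV. if r = k then 1 else 1 / of_nat l)"
      unfolding sum_pair by (simp add: sum_distrib_left)
    also have "(\<Sum>r\<in>UNIV. if r = k then 1 else 1 / of_nat l) = 1 + (\<Sum>r\<in>UNIV-{k}. 1 / (of_nat l :: complex))"
      by (subst sum.remove[of _ k]) auto
    also have "\<dots> = \<gamma>"
      using l0 l by (simp add: \<gamma>_def of_nat_diff field_simps)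
    finally show ?thesis by simp
  qed
  have inner: "(\<Sum>y\<in>?I. hform l p q z (w y) (\<xi> y) \<eta>) = (p * \<gamma> + q) * ((z $ k) ^ (l - 1) * cinner z \<eta>)" for z \<eta>
  proof -
    have "(\<Sum>y\<in>?I. hform l p q z (w y) (\<xi> y) \<eta>) =
      p * cinner z \<eta> * (\<Sum>x\<in>?I. cinner z (w x) ^ (l - 1) * cinner (\<xi> x) (w x)) +
      q * (\<Sum>x\<in>?I. cinner z (w x) ^ l * cinner (\<xi> x) \<eta>)"
      by (simp add: hform_def sum.distrib sum_distrib_left mult_ac)
    then show ?thesis unfolding sum1 sum2 by (simp add: algebra_simps)
  qed
  have wk: "w x $ k = 1" for x
    by (cases x) (auto simp: w_def axis_def)
  have "(\<Sum>x\<in>?I. \<Sum>y\<in>?I. hform l p q (w x) (w y) (\<xi> y) (\<xi> x)) = (p * \<gamma> + q) * (\<Sum>x\<in>?I. cinner (w x) (\<xi> x))"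
    by (simp add: inner wk sum_distrib_left)
  \<comment> \<open>All points have \<open>k\<close>-th coordinate 1, so the inserted powers are 1
    and \<open>sum2\<close> applies at \<open>axis k 1\<close>.\<close>
  also have "(\<Sum>x\<in>?I. cinner (w x) (\<xi> x)) = cnj (\<Sum>x\<in>?I. cinner (axis k 1) (w x) ^ (l - 1) * cinner (\<xi> x) (w x))"
    by (simp add: cnj_cinner cinner_axis_left wk)
  also have "\<dots> = cnj \<gamma>" by (simp only: sum2) simp
  also have "\<dots> = \<gamma>" by (simp add: \<gamma>_def)
  finally have "(p * \<gamma> + q) * \<gamma> \<in> \<real>\<^sub>\<ge>\<^sub>0"
    using pos_formD[OF pos, of ?I w \<xi>] by simp
  moreover have \<gamma>: "\<gamma> \<in> \<real>\<^sub>\<ge>\<^sub>0" "\<gamma> \<noteq> 0"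
  proof -
    have "l + CARD('n) - 1 > 0" using l zero_less_card_finite[where 'a='n] by linarith
    then show "\<gamma> \<noteq> 0" unfolding \<gamma>_def using l0 by (metis divide_eq_0_iff of_nat_eq_0_iff less_irrefl)
    show "\<gamma> \<in> \<real>\<^sub>\<ge>\<^sub>0" unfolding \<gamma>_def by (intro nonneg_Reals_divide_I nonneg_Reals_of_nat_I)
  qed
  ultimately have "(p * \<gamma> + q) * \<gamma> / \<gamma> \<in> \<real>\<^sub>\<ge>\<^sub>0"
    by (intro nonneg_Reals_divide_I)
  then have "(p * \<gamma> + q) * of_nat l \<in> \<real>\<^sub>\<ge>\<^sub>0"
    using \<gamma>(2) by (intro nonneg_Reals_mult_I nonneg_Reals_of_nat_I) simp
  also have "(p * \<gamma> + q) * of_nat l = of_nat (l + CARD('n) - 1) * p + of_nat l * q"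
    unfolding \<gamma>_def using l0 by (simp add: field_simps)
  finally show ?thesis .
qed

section \<open>Separating the homogeneous parts\<close>

lemma sums_nonneg_Reals:
  assumes "f sums s" "\<And>n. f n \<in> \<real>\<^sub>\<ge>\<^sub>0"
  shows "(s::complex) \<in> \<real>\<^sub>\<ge>\<^sub>0"
  using assms unfolding sums_def
  by (intro Lim_in_closed_set[OF closed_nonneg_Reals_complex, of _ sequentially])
    (auto intro!: always_eventually nonneg_Reals_sum)

text \<open>Convergence at \<open>x0 / 2\<close> gives convergence on a disc, so the constant
  coefficient is the limit of nonnegative sums as \<open>x\<close> decreases to 0, and the
  nonnegative reals are closed.\<close>

lemma powser_coeff_0_nonneg:
  fixes b :: "nat \<Rightarrow> complex"
  assumes "x0 > 0" and b: "\<And>x. 0 < x \<Longrightarrow> x < x0 \<Longrightarrow> \<exists>s\<in>\<real>\<^sub>\<ge>\<^sub>0. (\<lambda>k. b k * of_real x ^ k) sums s"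
  shows "b 0 \<in> \<real>\<^sub>\<ge>\<^sub>0"
proof -
  define f where "f x = (\<Sum>k. b k * x ^ k)" for x
  have sm: "summable (\<lambda>k. b k * of_real (x0 / 2) ^ k)"
    using b[of "x0 / 2"] assms(1) by (auto simp: sums_iff)
  have "(\<lambda>k. b k * x ^ k) sums f x" if "norm x < x0 / 2" for x
    unfolding f_def using powser_inside[OF sm, of x] that assms(1) by (intro summable_sums) auto
  then have lim: "(f \<longlongrightarrow> b 0) (at 0)"
    using assms(1) by (intro powser_limit_0[of "x0 / 2"]) auto
  have "((\<lambda>x. f (of_real x)) \<longlongrightarrow> b 0) (at_right 0)"
  proof (rule filterlim_compose[OF lim])
    show "filterlim complex_of_real (at 0) (at_right 0)"
      unfolding filterlim_at
      by (auto simp: eventually_at_filter intro!: tendsto_eq_intros)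
  qed
  moreover have "\<forall>\<^sub>F x in at_right 0. f (of_real x) \<in> \<real>\<^sub>\<ge>\<^sub>0"
    using eventually_at_right_real[OF assms(1)]
  proof eventually_elim
    case (elim x)
    then show ?case using b[of x] unfolding f_def by (auto simp: sums_iff)
  qed
  ultimately show ?thesis
    by (intro Lim_in_closed_set[OF closed_nonneg_Reals_complex]) (auto simp: trivial_limit_at_right_real)
qed

lemma powser_leading_coeff_nonneg:
  fixes b :: "nat \<Rightarrow> complex"
  assumes "x0 > 0" and b: "\<And>x. 0 < x \<Longrightarrow> x < x0 \<Longrightarrow> \<exists>s\<in>\<real>\<^sub>\<ge>\<^sub>0. (\<lambda>k. b k * of_real x ^ k) sums s"
    and zero: "\<And>k. k < l \<Longrightarrow> b k = 0"
  shows "b l \<in> \<real>\<^sub>\<ge>\<^sub>0"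
proof -
  have "\<exists>s\<in>\<real>\<^sub>\<ge>\<^sub>0. (\<lambda>k. b (k + l) * of_real x ^ k) sums s" if x: "0 < x" "x < x0" for x
  proof -
    obtain s where s: "s \<in> \<real>\<^sub>\<ge>\<^sub>0" "(\<lambda>k. b k * of_real x ^ k) sums s" using b[OF x] by blast
    have "(\<lambda>k. b (k + l) * of_real x ^ (k + l)) sums (s - (\<Sum>k<l. b k * of_real x ^ k))"
      using s(2) by (subst sums_iff_shift) simp
    then have "(\<lambda>k. b (k + l) * of_real x ^ (k + l) / of_real x ^ l) sums (s / of_real x ^ l)"
      using zero by (intro sums_divide) simp
    then have "(\<lambda>k. b (k + l) * of_real x ^ k) sums (s / of_real x ^ l)"
      using x by (simp add: power_add)
    moreover have "s / of_real x ^ l \<in> \<real>\<^sub>\<ge>\<^sub>0"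
      using s(1) x by (intro nonneg_Reals_divide_I nonneg_Reals_pow_I) auto
    ultimately show ?thesis by blast
  qed
  from powser_coeff_0_nonneg[OF assms(1) this] show ?thesis by simp
qed

section \<open>Isolating one degree of the kernel\<close>

lemma norm_scale_complex: "norm (c *s (x :: complex^'n)) = norm c * norm x"
  by (simp add: norm_vec_def norm_mult L2_set_right_distrib)

text \<open>The hypothesis is there because in degree 0 the truncated exponent would leave a
  \<open>p\<close>-term that is linear in \<open>z\<close>.\<close>

lemma hform_scale:
  assumes "k = 0 \<Longrightarrow> p = 0"
  shows "hform k p q (a *s z) (b *s w) (\<gamma> *s \<xi>) (\<delta> *s \<eta>) = (a * cnj b) ^ k * (\<gamma> * cnj \<delta>) * hform k p q z w \<xi> \<eta>"
  using assms by (cases k) (simp_all add: hform_def cinner_scale_left cinner_scale_right power_mult_distrib algebra_simps)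

text \<open>The points are multiplied by \<open>r * u j\<close> and the vectors by
  \<open>u j ^ l\<close>. The Gram sum becomes a power series in \<open>x = r * r\<close> with
  coefficients \<open>c k * (G k * cnj (G k))\<close>. Since \<open>G k = 0\<close> for
  \<open>k < l\<close>, the \<open>l\<close>-th coefficient leads; higher terms need not
  cancel.\<close>

lemma pos_form_series_term:
  fixes B :: "complex^'n \<Rightarrow> complex^'n \<Rightarrow> complex^'n \<Rightarrow> complex^'n \<Rightarrow> complex"
  assumes B: "\<And>z w \<xi> \<eta>. z \<in> ball 0 1 \<Longrightarrow> w \<in> ball 0 1 \<Longrightarrow> (\<lambda>l. hform l (p l) (q l) z w \<xi> \<eta>) sums B z w \<xi> \<eta>"
    and p0: "p 0 = 0" and pos: "pos_form (ball 0 1) B"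
  shows "pos_form UNIV (hform l (p l) (q l) :: complex^'n \<Rightarrow> complex^'n \<Rightarrow> complex^'n \<Rightarrow> complex^'n \<Rightarrow> complex)"
  unfolding pos_form_def
proof (intro allI impI)
  fix m :: nat and ws xis :: "nat \<Rightarrow> complex^'n"
  define c where "c k = (\<Sum>i<m. \<Sum>j<m. hform k (p k) (q k) (ws i) (ws j) (xis j) (xis i))" for k
  define N where "N = Suc l"
  define u where "u = unity_root N"
  define G where "G k = (\<Sum>j<N. u j ^ k * cnj (u j) ^ l)" for k
  \<comment> \<open>Every point has norm below \<open>R\<close>, so dilation by
    \<open>r < 1 / R\<close> moves it into the unit ball.\<close>
  define R where "R = 1 + (\<Sum>i<m. norm (ws i))"
  have R: "R \<ge> 1" by (simp add: R_def sum_nonneg)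
  have wR: "norm (ws i) < R" if "i < m" for i
    using member_le_sum[of i "{..<m}" "\<lambda>i. norm (ws i)"] that by (simp add: R_def)
  define b where "b k = c k * (G k * cnj (G k))" for k
  have "b l \<in> \<real>\<^sub>\<ge>\<^sub>0"
  proof (rule powser_leading_coeff_nonneg)
    show "(1 / R)\<^sup>2 > 0" using R by simp
  next
    fix k assume "k < l"
    then have "G k = 0" unfolding G_def u_def by (subst sum_unity_root_powers) (auto simp: N_def)
    then show "b k = 0" by (simp add: b_def)
  next
    fix x :: real assume x: "0 < x" "x < (1 / R)\<^sup>2"
    define r where "r = sqrt x"
    have r: "r > 0" "r < 1 / R" "r * r = x"
      using x R real_sqrt_less_mono[OF x(2)] by (auto simp: r_def)
    let ?I = "{..<m} \<times> {..<N}"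
    define w where "w = (\<lambda>(i, j). (of_real r * u j) *s ws i)"
    define \<xi> where "\<xi> = (\<lambda>(i, j). (u j ^ l) *s xis i)"
    have sum_pair: "(\<Sum>x\<in>?I. f x) = (\<Sum>i<m. \<Sum>j<N. f (i, j))" for f :: "nat \<times> nat \<Rightarrow> complex"
      by (simp add: sum.cartesian_product)
    have wball: "w y \<in> ball 0 1" if "y \<in> ?I" for y
    proof -
      obtain i j where y: "y = (i, j)" "i < m" using \<open>y \<in> ?I\<close> by auto
      have "norm (w y) = r * norm (ws i)"
        using r by (simp add: y w_def norm_scale_complex norm_mult u_def)
      also have "\<dots> < r * R" using wR[OF y(2)] r by simp
      also have "\<dots> \<le> 1" using r R by (simp add: field_simps)
      finally show ?thesis by simp
    qed
    have "(\<lambda>k. \<Sum>y\<in>?I. \<Sum>y'\<in>?I. hform k (p k) (q k) (w y) (w y') (\<xi> y') (\<xi> y)) sums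
       (\<Sum>y\<in>?I. \<Sum>y'\<in>?I. B (w y) (w y') (\<xi> y') (\<xi> y))"
      by (intro sums_sum B wball)
    moreover have "(\<Sum>y\<in>?I. \<Sum>y'\<in>?I. hform k (p k) (q k) (w y) (w y') (\<xi> y') (\<xi> y)) = b k * of_real x ^ k" for k
    proof -
      let ?h = "\<lambda>i i'. hform k (p k) (q k) (ws i) (ws i') (xis i') (xis i)"
      have "(\<Sum>y\<in>?I. \<Sum>y'\<in>?I. hform k (p k) (q k) (w y) (w y') (\<xi> y') (\<xi> y)) =
        (\<Sum>i<m. \<Sum>j<N. \<Sum>i'<m. \<Sum>j'<N. of_real x ^ k * ?h i i' * ((u j ^ k * cnj (u j) ^ l) * cnj (u j' ^ k * cnj (u j') ^ l)))"
        unfolding sum_pair w_def \<xi>_def split_conv using p0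
        by (intro sum.cong refl, subst hform_scale)
          (auto simp: r(3)[symmetric] power_mult_distrib mult_ac)
      also have "\<dots> = (\<Sum>i<m. \<Sum>i'<m. \<Sum>j<N. \<Sum>j'<N. of_real x ^ k * ?h i i' * ((u j ^ k * cnj (u j) ^ l) * cnj (u j' ^ k * cnj (u j') ^ l)))"
        by (rule sum.cong[OF refl], rule sum.swap)
      also have "\<dots> = (\<Sum>i<m. \<Sum>i'<m. of_real x ^ k * ?h i i' * (G k * cnj (G k)))"
        unfolding G_def cnj_sum sum_product unfolding sum_distrib_left by (rule refl)
      also have "\<dots> = b k * of_real x ^ k"
        by (simp add: b_def c_def sum_distrib_left sum_distrib_right mult_ac)
      finally show ?thesis .
    qed
    ultimately show "\<exists>s\<in>\<real>\<^sub>\<ge>\<^sub>0. (\<lambda>k. b k * of_real x ^ k) sums s"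
      using pos_formD[OF pos, of ?I w \<xi>] wball by (auto simp: finite_cartesian_product)
  qed
  moreover have "G l = of_nat N"
    unfolding G_def u_def by (subst sum_unity_root_powers) (auto simp: N_def)
  ultimately have "c l * (of_nat N * of_nat N) \<in> \<real>\<^sub>\<ge>\<^sub>0"
    by (simp add: b_def)
  then have "c l * (of_nat N * of_nat N) / (of_nat N * of_nat N) \<in> \<real>\<^sub>\<ge>\<^sub>0"
    by (rule nonneg_Reals_divide_I) (intro nonneg_Reals_mult_I nonneg_Reals_of_nat_I)
  then show "(\<Sum>i<m. \<Sum>j<m. hform l (p l) (q l) (ws i) (ws j) (xis j) (xis i)) \<in> \<real>\<^sub>\<ge>\<^sub>0"
    by (simp add: c_def N_def del: of_nat_Suc)
qed

text \<open>Applied later both to the kernel and to its product with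
  \<open>of_real C - cinner z w\<close>. Necessity isolates each degree; sufficiency passes to the
  limit of nonnegative partial sums.\<close>

lemma pos_form_series:
  fixes B :: "complex^'n \<Rightarrow> complex^'n \<Rightarrow> complex^'n \<Rightarrow> complex^'n \<Rightarrow> complex"
  assumes d2: "CARD('n) \<ge> 2"
    and B: "\<And>z w \<xi> \<eta>. z \<in> ball 0 1 \<Longrightarrow> w \<in> ball 0 1 \<Longrightarrow> (\<lambda>l. hform l (p l) (q l) z w \<xi> \<eta>) sums B z w \<xi> \<eta>"
    and p0: "p 0 = 0"
  shows "pos_form (ball 0 1) B \<longleftrightarrow>
    (\<forall>l. q l \<in> \<real>\<^sub>\<ge>\<^sub>0 \<and> of_nat (l + CARD('n) - 1) * p l + of_nat l * q l \<in> \<real>\<^sub>\<ge>\<^sub>0)"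
proof
  assume pos: "pos_form (ball 0 1) B"
  show "\<forall>l. q l \<in> \<real>\<^sub>\<ge>\<^sub>0 \<and> of_nat (l + CARD('n) - 1) * p l + of_nat l * q l \<in> \<real>\<^sub>\<ge>\<^sub>0"
  proof
    fix l
    have h: "pos_form UNIV (hform l (p l) (q l) :: complex^'n \<Rightarrow> complex^'n \<Rightarrow> complex^'n \<Rightarrow> complex^'n \<Rightarrow> complex)"
      by (rule pos_form_series_term[OF B p0 pos])
    show "q l \<in> \<real>\<^sub>\<ge>\<^sub>0 \<and> of_nat (l + CARD('n) - 1) * p l + of_nat l * q l \<in> \<real>\<^sub>\<ge>\<^sub>0"
      using pos_form_hformD_snd[OF d2 h] pos_form_hformD_fst[OF _ h] p0 by (cases "l = 0") auto
  qed
next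
  assume R: "\<forall>l. q l \<in> \<real>\<^sub>\<ge>\<^sub>0 \<and> of_nat (l + CARD('n) - 1) * p l + of_nat l * q l \<in> \<real>\<^sub>\<ge>\<^sub>0"
  have h: "pos_form UNIV (hform l (p l) (q l) :: complex^'n \<Rightarrow> complex^'n \<Rightarrow> complex^'n \<Rightarrow> complex^'n \<Rightarrow> complex)" for l
    using R p0 by (intro pos_form_hform) auto
  show "pos_form (ball 0 1) B"
    unfolding pos_form_def
  proof (intro allI impI)
    fix m :: nat and ws xis :: "nat \<Rightarrow> complex^'n"
    assume ws: "\<forall>j<m. ws j \<in> ball 0 1"
    have "(\<lambda>k. \<Sum>i<m. \<Sum>j<m. hform k (p k) (q k) (ws i) (ws j) (xis j) (xis i)) sums
      (\<Sum>i<m. \<Sum>j<m. B (ws i) (ws j) (xis j) (xis i))"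
      using ws by (intro sums_sum B) auto
    then show "(\<Sum>i<m. \<Sum>j<m. B (ws i) (ws j) (xis j) (xis i)) \<in> \<real>\<^sub>\<ge>\<^sub>0"
      by (rule sums_nonneg_Reals) (use h in \<open>auto simp: pos_form_def\<close>)
  qed
qed

section \<open>Multiplication operators and kernel inequalities\<close>

text \<open>A discriminant argument: reality at \<open>t = 1\<close> and \<open>t = \<i>\<close>
  forces \<open>y = cnj x\<close>, and \<open>t = - of_real u * cnj x\<close> then leaves a real
  quadratic in \<open>u\<close>.\<close>

lemma pos_quadratic_cauchy_schwarz:
  assumes "\<And>t. a + t * x + cnj t * y + t * cnj t * b \<in> \<real>\<^sub>\<ge>\<^sub>0" and a: "a \<in> \<real>\<^sub>\<ge>\<^sub>0" and b: "b \<in> \<real>\<^sub>\<ge>\<^sub>0"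
  shows "(norm x)\<^sup>2 \<le> Re a * Re b"
proof -
  obtain a' b' where ab: "a = of_real a'" "b = of_real b'" "a' \<ge> 0" "b' \<ge> 0"
    using a b by (auto elim!: nonneg_Reals_cases)
  have y: "y = cnj x"
    using assms(1)[of 1] assms(1)[of \<i>] by (auto simp: ab complex_nonneg_Reals_iff complex_eq_iff)
  have nx: "complex_of_real ((norm x)\<^sup>2) = x * cnj x" by (rule complex_norm_square)
  have *: "a' - 2 * u * (norm x)\<^sup>2 + u\<^sup>2 * (norm x)\<^sup>2 * b' \<ge> 0" for u
  proof -
    have "of_real (a' - 2 * u * (norm x)\<^sup>2 + u\<^sup>2 * (norm x)\<^sup>2 * b') =
      a + (- of_real u * cnj x) * x + cnj (- of_real u * cnj x) * y + (- of_real u * cnj x) * cnj (- of_real u * cnj x) * b"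
      by (simp only: of_real_add of_real_diff of_real_mult nx y ab complex_cnj_mult complex_cnj_minus
          complex_cnj_cnj complex_cnj_complex_of_real)
        (simp add: power2_eq_square algebra_simps)
    also have "\<dots> \<in> \<real>\<^sub>\<ge>\<^sub>0" by (rule assms(1))
    finally show ?thesis by (simp only: nonneg_Reals_of_real_iff)
  qed
  show ?thesis
  proof (cases "b' = 0")
    case True
    have "x = 0"
    proof (rule ccontr)
      assume "x \<noteq> 0"
      \<comment> \<open>For this \<open>u\<close> the expression, linear because
        \<open>b' = 0\<close>, takes the value -1.\<close>
      then show False using *[of "(a' + 1) / (2 * (norm x)\<^sup>2)"] True by simp
    qed
    then show ?thesis using ab by simp
  next
    case False
    then show ?thesis using *[of "1 / b'"] ab by (simp add: field_simps power2_eq_square)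
  qed
qed

section \<open>Gram forms and the norm of the reproducing kernel space\<close>

definition kform :: "(complex^'n \<Rightarrow> complex^'n \<Rightarrow> complex^'n^'n) \<Rightarrow>
    complex^'n \<Rightarrow> complex^'n \<Rightarrow> complex^'n \<Rightarrow> complex^'n \<Rightarrow> complex" where
  "kform K z w \<xi> \<eta> = cinner (K z w *v \<xi>) \<eta>"

lemma gram_form_eq_kform:
  "gram_form K m ws xis = (\<Sum>i<m. \<Sum>j<m. kform K (ws i) (ws j) (xis j) (xis i))"
  by (simp add: gram_form_def kform_def)

lemma nonneg_def_kernel_iff_pos_form: "nonneg_def_kernel K \<longleftrightarrow> pos_form (ball 0 1) (kform K)"
  unfolding nonneg_def_kernel_def pos_form_def gram_form_eq_kform complex_nonneg_Reals_iff by blast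

lemma kform_scale: "kform K z w (c *s \<xi>) (c' *s \<eta>) = c * cnj c' * kform K z w \<xi> \<eta>"
  unfolding kform_def cinner_scale_right
  by (simp add: vector_scalar_commute cinner_scale_left)

lemma kform_scale_left: "kform K z w (c *s \<xi>) \<eta> = c * kform K z w \<xi> \<eta>"
  using kform_scale[of K z w c \<xi> 1 \<eta>] by simp

lemma kform_scale_right: "kform K z w \<xi> (c *s \<eta>) = cnj c * kform K z w \<xi> \<eta>"
  using kform_scale[of K z w 1 \<xi> c \<eta>] by simp

lemma gram_form_nonneg:
  assumes "nonneg_def_kernel K" "\<And>j. j < m \<Longrightarrow> ws j \<in> ball 0 1"
  shows "gram_form K m ws xis \<in> \<real>\<^sub>\<ge>\<^sub>0"
  using assms unfolding nonneg_def_kernel_def complex_nonneg_Reals_iff by blast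

text \<open>The mixed sum is the inner product of two kernel combinations. Positivity is applied to
  the disjoint union of both families, the second scaled by \<open>t\<close>.\<close>

lemma gram_form_cauchy_schwarz:
  assumes K: "nonneg_def_kernel K"
    and v: "\<And>j. j < n \<Longrightarrow> v j \<in> ball 0 1" and w: "\<And>j. j < m \<Longrightarrow> w j \<in> ball 0 1"
  shows "(norm (\<Sum>i<n. \<Sum>j<m. kform K (v i) (w j) (\<eta> j) (\<zeta> i)))\<^sup>2
    \<le> Re (gram_form K n v \<zeta>) * Re (gram_form K m w \<eta>)"
proof (rule pos_quadratic_cauchy_schwarz)
  show "gram_form K n v \<zeta> \<in> \<real>\<^sub>\<ge>\<^sub>0" "gram_form K m w \<eta> \<in> \<real>\<^sub>\<ge>\<^sub>0"
    using gram_form_nonneg[OF K] v w by auto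
  fix t
  let ?I = "{..<n} <+> {..<m}"
  let ?w = "case_sum v w" and ?\<xi> = "case_sum \<zeta> (\<lambda>j. t *s \<eta> j)"
  have "(\<Sum>i\<in>?I. \<Sum>j\<in>?I. kform K (?w i) (?w j) (?\<xi> j) (?\<xi> i)) \<in> \<real>\<^sub>\<ge>\<^sub>0"
    using K v w unfolding nonneg_def_kernel_iff_pos_form
    by (intro pos_formD) auto
  also have "(\<Sum>i\<in>?I. \<Sum>j\<in>?I. kform K (?w i) (?w j) (?\<xi> j) (?\<xi> i)) =
    gram_form K n v \<zeta> + t * (\<Sum>i<n. \<Sum>j<m. kform K (v i) (w j) (\<eta> j) (\<zeta> i))
     + cnj t * (\<Sum>i<m. \<Sum>j<n. kform K (w i) (v j) (\<zeta> j) (\<eta> i)) + t * cnj t * gram_form K m w \<eta>"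
    by (simp add: sum.Plus gram_form_eq_kform kform_scale_left kform_scale_right sum.distrib sum_distrib_left algebra_simps)
  finally show "gram_form K n v \<zeta> + t * (\<Sum>i<n. \<Sum>j<m. kform K (v i) (w j) (\<eta> j) (\<zeta> i))
     + cnj t * (\<Sum>i<m. \<Sum>j<n. kform K (w i) (v j) (\<zeta> j) (\<eta> i)) + t * cnj t * gram_form K m w \<eta> \<in> \<real>\<^sub>\<ge>\<^sub>0" .
qed

text \<open>Dividing the vectors by \<open>c\<close> normalises the family. A free
  \<open>c > 0\<close> avoids division by a Gram value that may vanish.\<close>

lemma rk_vals_bound:
  assumes "in_RKHS K f" "\<And>j. j < m \<Longrightarrow> ws j \<in> ball 0 1" "Re (gram_form K m ws xis) \<le> c\<^sup>2" "c > 0"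
  shows "norm (\<Sum>j<m. cinner (f (ws j)) (xis j)) \<le> c * rk_norm K f"
proof -
  define s where "s = complex_of_real (1 / c)"
  have "gram_form K m ws (\<lambda>j. s *s xis j) = of_real (1 / c\<^sup>2) * gram_form K m ws xis"
    by (simp add: gram_form_eq_kform kform_scale sum_distrib_left s_def power2_eq_square)
  then have "Re (gram_form K m ws (\<lambda>j. s *s xis j)) = Re (gram_form K m ws xis) / c\<^sup>2"
    by (simp only: Re_complex_of_real times_complex.sel Im_complex_of_real) simp
  then have "Re (gram_form K m ws (\<lambda>j. s *s xis j)) \<le> 1"
    using assms by simp
  then have "norm (\<Sum>j<m. cinner (f (ws j)) (s *s xis j)) \<in> rk_vals K f"
    unfolding rk_vals_def using assms(2)
    by (intro CollectI exI[of _ m] exI[of _ ws] exI[of _ "\<lambda>j. s *s xis j"]) auto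
  then have "norm (\<Sum>j<m. cinner (f (ws j)) (s *s xis j)) \<le> rk_norm K f"
    using assms(1) unfolding rk_norm_def in_RKHS_def by (rule cSup_upper)
  also have "(\<Sum>j<m. cinner (f (ws j)) (s *s xis j)) = s * (\<Sum>j<m. cinner (f (ws j)) (xis j))"
    by (simp add: cinner_scale_right s_def sum_distrib_left)
  finally show ?thesis using assms(4) by (simp add: s_def norm_mult norm_divide field_simps)
qed

lemma in_RKHS_rk_norm_leI:
  assumes "\<And>m ws xis. (\<And>j. j < m \<Longrightarrow> ws j \<in> ball 0 1) \<Longrightarrow> Re (gram_form K m ws xis) \<le> 1 \<Longrightarrow>
    norm (\<Sum>j<m. cinner (f (ws j)) (xis j)) \<le> c"
  shows "in_RKHS K f" "rk_norm K f \<le> c"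
proof -
  have le: "x \<le> c" if "x \<in> rk_vals K f" for x
    using that assms unfolding rk_vals_def by blast
  then show "in_RKHS K f" unfolding in_RKHS_def by (rule bdd_aboveI)
  \<comment> \<open>The empty family makes \<open>rk_vals\<close> nonempty, so that its supremum can
    be bounded.\<close>
  have "gram_form K 0 undefined undefined = 0" by (simp add: gram_form_def)
  then have "norm (\<Sum>j<0::nat. cinner (f (undefined j)) (undefined j)) \<in> rk_vals K f"
    unfolding rk_vals_def by fastforce
  then show "rk_norm K f \<le> c" unfolding rk_norm_def using le by (intro cSup_least) auto
qed

section \<open>Coordinate multiplication and its adjoint\<close>

text \<open>The vectors \<open>cnj (ws j $ k) *s xis j\<close> come from applying the adjoint of the
  \<open>k\<close>-th multiplication to a kernel combination. Over all \<open>k\<close> the products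
  \<open>ws i $ k * cnj (ws j $ k)\<close> add up to \<open>cinner (ws i) (ws j)\<close>.\<close>

lemma sum_gram_form_coord:
  "(\<Sum>k\<in>UNIV. gram_form K m ws (\<lambda>j. cnj (ws j $ k) *s xis j)) =
   (\<Sum>i<m. \<Sum>j<m. cinner (ws i) (ws j) * kform K (ws i) (ws j) (xis j) (xis i))"
proof -
  have "(\<Sum>k\<in>UNIV. gram_form K m ws (\<lambda>j. cnj (ws j $ k) *s xis j)) =
    (\<Sum>i<m. \<Sum>k\<in>UNIV. \<Sum>j<m. ws i $ k * cnj (ws j $ k) * kform K (ws i) (ws j) (xis j) (xis i))"
    unfolding gram_form_eq_kform by (subst sum.swap) (simp add: kform_scale mult_ac)
  also have "\<dots> = (\<Sum>i<m. \<Sum>j<m. \<Sum>k\<in>UNIV. ws i $ k * cnj (ws j $ k) * kform K (ws i) (ws j) (xis j) (xis i))"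
    by (rule sum.cong[OF refl], rule sum.swap)
  finally show ?thesis by (simp add: cinner_def sum_distrib_right)
qed

lemma mult_coord_functional:
  "(\<Sum>j<m. cinner (mult_coord k f (ws j)) (xis j)) =
   (\<Sum>j<m. cinner (f (ws j)) (cnj (ws j $ k) *s xis j))"
  by (simp add: mult_coord_def cinner_scale_left cinner_scale_right)

text \<open>The hypothesis bounds the sum over all coordinates of the Gram forms of the adjoint
  images by \<open>C\<close> times the original one; the summands are nonnegative, so each obeys
  this bound.\<close>

lemma coord_mult_bounded_if_pos_form:
  assumes K: "nonneg_def_kernel K"
    and pos: "pos_form (ball 0 1) (\<lambda>z w \<xi> \<eta>. (of_real C - cinner z w) * kform K z w \<xi> \<eta>)"
  shows "coord_mult_bounded K"
  unfolding coord_mult_bounded_def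
proof (intro allI exI impI)
  fix k f assume f: "in_RKHS K f"
  \<comment> \<open>\<open>C\<close> may be zero or negative, while \<open>rk_vals_bound\<close>
    needs a positive constant; any \<open>D > 0\<close> with \<open>C \<le> D\<^sup>2\<close> would
    do.\<close>
  define D where "D = sqrt (max C 0) + 1"
  have D: "D > 0" by (simp add: D_def add_nonneg_pos)
  have "C \<le> (sqrt (max C 0))\<^sup>2" by simp
  also have "\<dots> \<le> D\<^sup>2" unfolding D_def by (intro power_mono) auto
  finally have CD: "C \<le> D\<^sup>2" .
  have *: "norm (\<Sum>j<m. cinner (mult_coord k f (ws j)) (xis j)) \<le> D * rk_norm K f"
    if ws: "\<And>j. j < m \<Longrightarrow> ws j \<in> ball 0 1" and G: "Re (gram_form K m ws xis) \<le> 1" for m ws xis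
    unfolding mult_coord_functional
  proof (rule rk_vals_bound[OF f ws _ D])
    let ?G = "\<lambda>k. gram_form K m ws (\<lambda>j. cnj (ws j $ k) *s xis j)"
    have nn: "?G k \<in> \<real>\<^sub>\<ge>\<^sub>0" for k using gram_form_nonneg[OF K ws] .
    have G0: "gram_form K m ws xis \<in> \<real>\<^sub>\<ge>\<^sub>0" using gram_form_nonneg[OF K ws] .
    have "of_real C * gram_form K m ws xis - (\<Sum>k\<in>UNIV. ?G k) \<in> \<real>\<^sub>\<ge>\<^sub>0"
      using pos ws unfolding pos_form_def sum_gram_form_coord unfolding gram_form_eq_kform
      by (simp add: left_diff_distrib sum_subtractf sum_distrib_left)
    then have "Re (\<Sum>k\<in>UNIV. ?G k) \<le> C * Re (gram_form K m ws xis)"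
      by (simp add: complex_nonneg_Reals_iff)
    moreover have "Re (?G k) \<le> Re (\<Sum>k\<in>UNIV. ?G k)"
      unfolding Re_sum using nn by (intro member_le_sum) (auto simp: complex_nonneg_Reals_iff)
    moreover have "C * Re (gram_form K m ws xis) \<le> D\<^sup>2 * 1"
      using CD G G0 by (intro order_trans[OF mult_right_mono mult_left_mono]) (auto simp: complex_nonneg_Reals_iff)
    ultimately show "Re (?G k) \<le> D\<^sup>2" by simp
  qed
  show "in_RKHS K (mult_coord k f) \<and> rk_norm K (mult_coord k f) \<le> D * rk_norm K f"
    using in_RKHS_rk_norm_leI[of K "mult_coord k f", OF *] by blast
qed

text \<open>Testing the multiplication operator on the kernel combination that represents the functional
  itself bounds its adjoint, which multiplies the coefficients by the conjugate coordinates.\<close>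

lemma gram_form_coord_le:
  assumes K: "nonneg_def_kernel K"
    and bdd: "\<And>f. in_RKHS K f \<Longrightarrow>
         in_RKHS K (mult_coord k f) \<and> rk_norm K (mult_coord k f) \<le> C * rk_norm K f"
    and ws: "\<And>j. j < m \<Longrightarrow> ws j \<in> ball 0 1"
  shows "Re (gram_form K m ws (\<lambda>j. cnj (ws j $ k) *s xis j)) \<le> C\<^sup>2 * Re (gram_form K m ws xis)"
proof -
  define \<eta> where "\<eta> j = cnj (ws j $ k) *s xis j" for j
  define G where "G = Re (gram_form K m ws xis)"
  define H where "H = Re (gram_form K m ws \<eta>)"
  have G: "G \<ge> 0" and H: "H \<ge> 0" and H': "gram_form K m ws \<eta> = of_real H"
    using gram_form_nonneg[OF K ws, where xis = xis] gram_form_nonneg[OF K ws, where xis = \<eta>]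
    by (auto simp: G_def H_def complex_nonneg_Reals_iff complex_eq_iff)
  \<comment> \<open>This kernel combination represents the functional to be bounded; by
    Cauchy-Schwarz its norm is at most \<open>sqrt H\<close>.\<close>
  define f where "f z = (\<Sum>j<m. K z (ws j) *v \<eta> j)" for z
  have Lf: "(\<Sum>i<n. cinner (f (v i)) (\<zeta> i)) = (\<Sum>i<n. \<Sum>j<m. kform K (v i) (ws j) (\<eta> j) (\<zeta> i))" for n v \<zeta>
    by (simp add: f_def cinner_sum_left kform_def)
  have *: "norm (\<Sum>i<n. cinner (f (v i)) (\<zeta> i)) \<le> sqrt H"
    if v: "\<And>j. j < n \<Longrightarrow> v j \<in> ball 0 1" and le: "Re (gram_form K n v \<zeta>) \<le> 1" for n v \<zeta>
  proof (rule real_le_rsqrt)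
    have "(norm (\<Sum>i<n. cinner (f (v i)) (\<zeta> i)))\<^sup>2 \<le> Re (gram_form K n v \<zeta>) * H"
      unfolding Lf H_def by (rule gram_form_cauchy_schwarz[OF K v ws])
    also have "\<dots> \<le> 1 * H" using le H by (rule mult_right_mono)
    finally show "(norm (\<Sum>i<n. cinner (f (v i)) (\<zeta> i)))\<^sup>2 \<le> H" by simp
  qed
  have f: "in_RKHS K f" "rk_norm K f \<le> sqrt H"
    using in_RKHS_rk_norm_leI[of K f "sqrt H", OF *] by blast+
  have f0: "rk_norm K f \<ge> 0"
    using rk_vals_bound[OF f(1), of 0 "\<lambda>_. 0" "\<lambda>_. 0" 1] by (simp add: gram_form_def)
  \<comment> \<open>\<open>\<delta>\<close> keeps the constant in \<open>rk_vals_bound\<close>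
    positive when \<open>G = 0\<close>; it is removed at the end by letting it tend to 0.\<close>
  have le: "H \<le> C\<^sup>2 * (G + \<delta>)" if "\<delta> > 0" for \<delta>
  proof (cases "H = 0")
    case False
    have e: "sqrt (G + \<delta>) > 0" "G \<le> (sqrt (G + \<delta>))\<^sup>2" using G that by auto
    have "H = norm (\<Sum>j<m. cinner (mult_coord k f (ws j)) (xis j))"
      unfolding mult_coord_functional \<eta>_def[symmetric] Lf
      using H H' by (simp add: gram_form_eq_kform)
    also have "\<dots> \<le> sqrt (G + \<delta>) * rk_norm K (mult_coord k f)"
      by (rule rk_vals_bound) (use bdd[OF f(1)] ws e in \<open>auto simp: G_def[symmetric]\<close>)
    also have "\<dots> \<le> sqrt (G + \<delta>) * (\<bar>C\<bar> * sqrt H)"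
    proof (rule mult_left_mono)
      have "rk_norm K (mult_coord k f) \<le> C * rk_norm K f" using bdd[OF f(1)] by blast
      also have "\<dots> \<le> \<bar>C\<bar> * rk_norm K f" using f0 by (intro mult_right_mono) auto
      also have "\<dots> \<le> \<bar>C\<bar> * sqrt H" using f(2) by (intro mult_left_mono) auto
      finally show "rk_norm K (mult_coord k f) \<le> \<bar>C\<bar> * sqrt H" .
    qed (use e in auto)
    finally have "sqrt H * sqrt H \<le> (sqrt (G + \<delta>) * \<bar>C\<bar>) * sqrt H" using H by (simp add: mult_ac)
    then have "sqrt H \<le> sqrt (G + \<delta>) * \<bar>C\<bar>"
      by (rule mult_right_le_imp_le) (use H False in auto)
    then have "(sqrt H)\<^sup>2 \<le> (sqrt (G + \<delta>) * \<bar>C\<bar>)\<^sup>2" using H by (intro power_mono) auto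
    then show ?thesis using H G that by (simp add: power_mult_distrib mult_ac)
  qed (use G that in auto)
  have "H \<le> C\<^sup>2 * G"
  proof (rule field_le_epsilon)
    fix \<epsilon> :: real assume \<epsilon>: "\<epsilon> > 0"
    have pos: "C\<^sup>2 + 1 > 0" by (simp add: add_nonneg_pos)
    have "H \<le> C\<^sup>2 * (G + \<epsilon> / (C\<^sup>2 + 1))" using \<epsilon> pos by (intro le) auto
    also have "\<dots> \<le> C\<^sup>2 * G + \<epsilon>" using \<epsilon> pos by (simp add: field_simps)
    finally show "H \<le> C\<^sup>2 * G + \<epsilon>" .
  qed
  then show ?thesis by (simp add: G_def H_def \<eta>_def[abs_def])
qed

lemma coord_mult_bounded_iff_pos_form:
  fixes K :: "complex^'n \<Rightarrow> complex^'n \<Rightarrow> complex^'n^'n"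
  assumes K: "nonneg_def_kernel K"
  shows "coord_mult_bounded K \<longleftrightarrow>
    (\<exists>C. pos_form (ball 0 1) (\<lambda>z w \<xi> \<eta>. (of_real C - cinner z w) * kform K z w \<xi> \<eta>))"
proof
  assume "coord_mult_bounded K"
  then obtain C where C: "\<And>k f. in_RKHS K f \<Longrightarrow>
         in_RKHS K (mult_coord k f) \<and> rk_norm K (mult_coord k f) \<le> C k * rk_norm K f"
    unfolding coord_mult_bounded_def by metis
  \<comment> \<open>The adjoint bounds add up over the coordinates, so the sum of the squares is a
    common constant.\<close>
  define C' where "C' = (\<Sum>k\<in>UNIV. (C k)\<^sup>2)"
  have "pos_form (ball 0 1) (\<lambda>z w \<xi> \<eta>. (of_real C' - cinner z w) * kform K z w \<xi> \<eta>)"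
    unfolding pos_form_def
  proof (intro allI impI)
    fix m :: nat and ws xis :: "nat \<Rightarrow> complex^'n"
    assume "\<forall>j<m. ws j \<in> ball 0 1"
    then have ws: "\<And>j. j < m \<Longrightarrow> ws j \<in> ball 0 1" by blast
    let ?G = "\<lambda>k. gram_form K m ws (\<lambda>j. cnj (ws j $ k) *s xis j)"
    have nn: "?G k \<in> \<real>\<^sub>\<ge>\<^sub>0" for k using gram_form_nonneg[OF K ws] .
    have G0: "gram_form K m ws xis \<in> \<real>\<^sub>\<ge>\<^sub>0" using gram_form_nonneg[OF K ws] .
    have "(\<Sum>i<m. \<Sum>j<m. (of_real C' - cinner (ws i) (ws j)) * kform K (ws i) (ws j) (xis j) (xis i)) =
      of_real C' * gram_form K m ws xis - (\<Sum>k\<in>UNIV. ?G k)"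
      unfolding sum_gram_form_coord unfolding gram_form_eq_kform
      by (simp add: left_diff_distrib sum_subtractf sum_distrib_left)
    also have "\<dots> = (\<Sum>k\<in>UNIV. of_real ((C k)\<^sup>2) * gram_form K m ws xis - ?G k)"
      by (simp add: C'_def sum_subtractf sum_distrib_right)
    also have "\<dots> \<in> \<real>\<^sub>\<ge>\<^sub>0"
    proof (rule nonneg_Reals_sum)
      fix k
      show "of_real ((C k)\<^sup>2) * gram_form K m ws xis - ?G k \<in> \<real>\<^sub>\<ge>\<^sub>0"
        using gram_form_coord_le[OF K C ws] nn[of k] G0
        by (simp add: complex_nonneg_Reals_iff del: of_real_power)
    qed
    finally show "(\<Sum>i<m. \<Sum>j<m. (of_real C' - cinner (ws i) (ws j)) * kform K (ws i) (ws j) (xis j) (xis i)) \<in> \<real>\<^sub>\<ge>\<^sub>0" .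
  qed
  then show "\<exists>C. pos_form (ball 0 1) (\<lambda>z w \<xi> \<eta>. (of_real C - cinner z w) * kform K z w \<xi> \<eta>)" by blast
next
  assume "\<exists>C. pos_form (ball 0 1) (\<lambda>z w \<xi> \<eta>. (of_real C - cinner z w) * kform K z w \<xi> \<eta>)"
  then show "coord_mult_bounded K" using coord_mult_bounded_if_pos_form[OF K] by blast
qed

section \<open>Comparison of coefficients\<close>

text \<open>Contracting the entries with \<open>\<xi>\<close> and \<open>\<eta>\<close> turns the
  rank-one matrix into \<open>cinner z \<eta> * cinner \<xi> w\<close> and the identity matrix into
  \<open>cinner \<xi> \<eta>\<close>.\<close>

lemma kform_sums:
  fixes K :: "complex^'n \<Rightarrow> complex^'n \<Rightarrow> complex^'n^'n"
  assumes K: "\<And>i j. (\<lambda>l. p l * cinner z w ^ (l - 1) * (z $ i * cnj (w $ j)) +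
      q l * cinner z w ^ l * (if i = j then 1 else 0)) sums (K z w $ i $ j)"
  shows "(\<lambda>l. hform l (p l) (q l) z w \<xi> \<eta>) sums kform K z w \<xi> \<eta>"
proof -
  have "(\<lambda>l. \<Sum>i\<in>UNIV. (\<Sum>j\<in>UNIV. (p l * cinner z w ^ (l - 1) * (z $ i * cnj (w $ j)) +
      q l * cinner z w ^ l * (if i = j then 1 else 0)) * \<xi> $ j) * cnj (\<eta> $ i)) sums
      (\<Sum>i\<in>UNIV. (\<Sum>j\<in>UNIV. K z w $ i $ j * \<xi> $ j) * cnj (\<eta> $ i))"
    by (intro sums_sum sums_mult2 K)
  moreover have "(\<Sum>i\<in>UNIV. (\<Sum>j\<in>UNIV. K z w $ i $ j * \<xi> $ j) * cnj (\<eta> $ i)) = kform K z w \<xi> \<eta>"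
    by (simp add: kform_def cinner_def matrix_vector_mult_def)
  moreover have "(\<Sum>i\<in>UNIV. (\<Sum>j\<in>UNIV. (p l * cinner z w ^ (l - 1) * (z $ i * cnj (w $ j)) +
      q l * cinner z w ^ l * (if i = j then 1 else 0)) * \<xi> $ j) * cnj (\<eta> $ i)) = hform l (p l) (q l) z w \<xi> \<eta>" for l
  proof -
    have "(\<Sum>j\<in>UNIV. (p l * cinner z w ^ (l - 1) * (z $ i * cnj (w $ j)) +
      q l * cinner z w ^ l * (if i = j then 1 else 0)) * \<xi> $ j) =
      p l * cinner z w ^ (l - 1) * z $ i * cinner \<xi> w + q l * cinner z w ^ l * \<xi> $ i" for i
    proof -
      have "(\<Sum>j\<in>UNIV. (p l * cinner z w ^ (l - 1) * (z $ i * cnj (w $ j)) +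
          q l * cinner z w ^ l * (if i = j then 1 else 0)) * \<xi> $ j) =
        (\<Sum>j\<in>UNIV. p l * cinner z w ^ (l - 1) * z $ i * (\<xi> $ j * cnj (w $ j))) +
        (\<Sum>j\<in>UNIV. if i = j then q l * cinner z w ^ l * \<xi> $ j else 0)"
        unfolding sum.distrib[symmetric] by (intro sum.cong refl) (auto simp: algebra_simps)
      then show ?thesis by (simp add: cinner_def[of \<xi>] sum_distrib_left)
    qed
    then show ?thesis
      by (simp add: hform_def cinner_def[of z \<eta>] cinner_def[of \<xi> \<eta>] sum_distrib_left
          sum_distrib_right sum.distrib algebra_simps)
  qed
  ultimately show ?thesis by simp
qed

text \<open>Translates a bound on a quotient of coefficients into the nonnegativity that positive
  forms deliver.\<close>

lemma norm_divide_le_iff_nonneg_Reals: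
  assumes "x \<in> \<real>\<^sub>\<ge>\<^sub>0" "y \<in> \<real>\<^sub>\<ge>\<^sub>0" "y \<noteq> (0::complex)"
  shows "norm (x / y) \<le> C \<longleftrightarrow> of_real C * y - x \<in> \<real>\<^sub>\<ge>\<^sub>0"
proof -
  obtain a b where ab: "x = of_real a" "y = of_real b" "a \<ge> 0" "b \<ge> 0"
    using assms by (auto elim!: nonneg_Reals_cases)
  then have "b > 0" using assms(3) by auto
  have "of_real C * y - x = of_real (C * b - a)" by (simp add: ab)
  then have "of_real C * y - x \<in> \<real>\<^sub>\<ge>\<^sub>0 \<longleftrightarrow> a \<le> C * b"
    by (simp only: nonneg_Reals_of_real_iff) simp
  moreover have "norm (x / y) = a / b" using ab by (simp add: norm_divide)
  ultimately show ?thesis using \<open>b > 0\<close> by (simp only: pos_divide_le_eq)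
qed

text \<open>The source of the coefficient shift. In degrees 0 and 1 the truncated exponents of the
  \<open>p\<close>-term coincide, hence the hypothesis.\<close>

lemma cinner_mult_hform:
  assumes "l = 0 \<Longrightarrow> p = 0"
  shows "cinner z w * hform l p q z w \<xi> \<eta> = hform (Suc l) p q z w \<xi> \<eta>"
  using assms by (cases l) (simp_all add: hform_def algebra_simps)

theorem theorem4p2:
  fixes K :: "complex^'n \<Rightarrow> complex^'n \<Rightarrow> complex^'n^'n"
    and a1 a2 :: "nat \<Rightarrow> complex"
  assumes d2: "CARD('n) \<ge> 2"
    and nnd: "nonneg_def_kernel K"
    and form: "\<forall>z\<in>ball 0 1. \<forall>w\<in>ball 0 1. \<forall>i j.
        summable (\<lambda>l. (a1 (Suc l) - a2 (Suc l)) * cinner z w ^ l * (z$i * cnj (w$j))) \<and>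
        summable (\<lambda>l. a2 l * cinner z w ^ l * (if i = j then 1 else 0)) \<and>
        K z w $ i $ j =
          (\<Sum>l. (a1 (Suc l) - a2 (Suc l)) * cinner z w ^ l * (z$i * cnj (w$j))) +
          (\<Sum>l. a2 l * cinner z w ^ l * (if i = j then 1 else 0))"
    and denoms: "\<forall>l\<ge>1. of_nat (l + CARD('n) - 1) * at1 a1 a2 l - of_nat (CARD('n) - 1) * a2 l \<noteq> 0
                       \<and> a2 l \<noteq> 0"
  shows "coord_mult_bounded K \<longleftrightarrow>
    (\<exists>C::real. \<forall>l\<ge>1.
       norm ((of_nat (l + CARD('n) - 1) * at1 a1 a2 (l - 1) - of_nat (CARD('n) - 1) * a2 (l - 1)) /
             (of_nat (l + CARD('n) - 1) * at1 a1 a2 l - of_nat (CARD('n) - 1) * a2 l)) \<le> C \<and>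
       norm (a2 (l - 1) / a2 l) \<le> C)"
proof -
  define p where "p l = at1 a1 a2 l - a2 l" for l
  define N where "N l = l + CARD('n) - 1" for l
  \<comment> \<open>The convention \<open>at1 a1 a2 0 = a2 0\<close> supplies the condition on
    \<open>p\<close> in degree 0.\<close>
  have p0: "p 0 = 0" by (simp add: p_def at1_def)
  have B: "(\<lambda>l. hform l (p l) (a2 l) z w \<xi> \<eta>) sums kform K z w \<xi> \<eta>"
    if zw: "z \<in> ball 0 1" "w \<in> ball 0 1" for z w \<xi> \<eta>
  proof (rule kform_sums)
    fix i j
    let ?f = "\<lambda>l. p l * cinner z w ^ (l - 1) * (z $ i * cnj (w $ j))"
    let ?g = "\<lambda>l. a2 l * cinner z w ^ l * (if i = j then 1 else 0)"
    have f: "?f (Suc l) = (a1 (Suc l) - a2 (Suc l)) * cinner z w ^ l * (z$i * cnj (w$j))" for l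
      by (simp add: p_def at1_def)
    have "summable (\<lambda>l. ?f (Suc l))" "summable ?g" and
      Kij: "K z w $ i $ j = (\<Sum>l. ?f (Suc l)) + (\<Sum>l. ?g l)"
      unfolding f using form zw by blast+
    then have "?f sums ((\<Sum>l. ?f (Suc l)) + ?f 0)" "?g sums (\<Sum>l. ?g l)"
      by (intro sums_Suc summable_sums; simp)+
    then show "(\<lambda>l. ?f l + ?g l) sums (K z w $ i $ j)"
      unfolding Kij p0 by (intro sums_add) auto
  qed
  \<comment> \<open>Coefficients of the product with \<open>of_real C - cinner z w\<close>; degree 0
    has no predecessor to subtract.\<close>
  define p' where "p' C l = of_real C * p l - (if l = 0 then 0 else p (l - 1))" for C l
  define q' where "q' C l = of_real C * a2 l - (if l = 0 then 0 else a2 (l - 1))" for C l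
  have B': "(\<lambda>l. hform l (p' C l) (q' C l) z w \<xi> \<eta>) sums ((of_real C - cinner z w) * kform K z w \<xi> \<eta>)"
    if zw: "z \<in> ball 0 1" "w \<in> ball 0 1" for z w \<xi> \<eta> C
  proof -
    let ?f = "\<lambda>l. if l = 0 then 0 else hform l (p (l - 1)) (a2 (l - 1)) z w \<xi> \<eta>"
    have "(\<lambda>l. cinner z w * hform l (p l) (a2 l) z w \<xi> \<eta>) sums (cinner z w * kform K z w \<xi> \<eta>)"
      by (intro sums_mult B zw)
    then have "(\<lambda>l. ?f (Suc l)) sums (cinner z w * kform K z w \<xi> \<eta>)"
      using p0 by (simp add: cinner_mult_hform)
    then have "?f sums (cinner z w * kform K z w \<xi> \<eta>)"
      using sums_Suc[of ?f] by simp
    then have "(\<lambda>l. of_real C * hform l (p l) (a2 l) z w \<xi> \<eta> - ?f l) sums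
      (of_real C * kform K z w \<xi> \<eta> - cinner z w * kform K z w \<xi> \<eta>)"
      by (intro sums_diff sums_mult B zw)
    moreover have "of_real C * hform l (p l) (a2 l) z w \<xi> \<eta> - ?f l = hform l (p' C l) (q' C l) z w \<xi> \<eta>" for l
      by (simp add: hform_def p'_def q'_def algebra_simps)
    ultimately show ?thesis by (simp add: left_diff_distrib)
  qed
  have q: "a2 l \<in> \<real>\<^sub>\<ge>\<^sub>0" and n: "of_nat (N l) * p l + of_nat l * a2 l \<in> \<real>\<^sub>\<ge>\<^sub>0" for l
    using nnd pos_form_series[OF d2 B p0] unfolding nonneg_def_kernel_iff_pos_form N_def by blast+
  have of_N: "of_nat (N l) = of_nat l + (of_nat (CARD('n) - 1) :: complex)" for l
    using d2 by (simp add: N_def flip: of_nat_add)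
  \<comment> \<open>Rewrites the first fraction in terms of \<open>p\<close> and \<open>a2\<close>:
    \<open>k = l\<close> gives its denominator and \<open>k = l - 1\<close> its numerator.\<close>
  have eq: "of_nat (N l) * at1 a1 a2 k - of_nat (CARD('n) - 1) * a2 k = of_nat (N l) * p k + of_nat l * a2 k" for l k
    unfolding of_N p_def by (simp add: algebra_simps)
  \<comment> \<open>The numerator pairs \<open>N (Suc k)\<close> with coefficients of index
    \<open>k\<close>, so it exceeds the quantity in \<open>n\<close> by \<open>p k + a2 k\<close>.
    That excess is nonnegative because \<open>of_nat (N k)\<close> times it is a sum of nonnegative
    terms.\<close>
  have e: "of_nat (N (Suc k)) * p k + of_nat (Suc k) * a2 k \<in> \<real>\<^sub>\<ge>\<^sub>0" for k
  proof -
    have N0: "(of_nat (N k) :: complex) \<noteq> 0" using d2 by (simp add: N_def del: of_nat_diff)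
    have "((of_nat (N k) * p k + of_nat k * a2 k) + of_nat (CARD('n) - 1) * a2 k) / of_nat (N k) \<in> \<real>\<^sub>\<ge>\<^sub>0"
      by (intro nonneg_Reals_divide_I nonneg_Reals_of_nat_I nonneg_Reals_add_I[OF n] nonneg_Reals_mult_I q)
    also have "((of_nat (N k) * p k + of_nat k * a2 k) + of_nat (CARD('n) - 1) * a2 k) / of_nat (N k) = p k + a2 k"
      using N0 unfolding of_N by (simp add: field_simps)
    finally have "(of_nat (N k) * p k + of_nat k * a2 k) + (p k + a2 k) \<in> \<real>\<^sub>\<ge>\<^sub>0"
      by (rule nonneg_Reals_add_I[OF n])
    then show ?thesis unfolding of_N by (simp add: algebra_simps)
  qed
  have pos_iff: "pos_form (ball 0 1) (\<lambda>z w \<xi> \<eta>. (of_real C - cinner z w) * kform K z w \<xi> \<eta>) \<longleftrightarrow>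
    (\<forall>l. q' C l \<in> \<real>\<^sub>\<ge>\<^sub>0 \<and> of_nat (N l) * p' C l + of_nat l * q' C l \<in> \<real>\<^sub>\<ge>\<^sub>0)" for C
    unfolding N_def by (rule pos_form_series[OF d2 B']) (simp_all add: p'_def p0)
  \<comment> \<open>In degree \<open>Suc k\<close> both conditions have the form
    \<open>of_real C * y - x\<close> with \<open>x\<close> and \<open>y\<close> nonnegative and
    \<open>y\<close> nonzero by \<open>denoms\<close>, so each bounds one quotient by
    \<open>C\<close>.\<close>
  have term_iff: "q' C (Suc k) \<in> \<real>\<^sub>\<ge>\<^sub>0 \<and> of_nat (N (Suc k)) * p' C (Suc k) + of_nat (Suc k) * q' C (Suc k) \<in> \<real>\<^sub>\<ge>\<^sub>0 \<longleftrightarrow>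
    norm ((of_nat (N (Suc k)) * at1 a1 a2 k - of_nat (CARD('n) - 1) * a2 k) /
          (of_nat (N (Suc k)) * at1 a1 a2 (Suc k) - of_nat (CARD('n) - 1) * a2 (Suc k))) \<le> C \<and>
    norm (a2 k / a2 (Suc k)) \<le> C" for C k
  proof -
    have nz: "of_nat (N (Suc k)) * p (Suc k) + of_nat (Suc k) * a2 (Suc k) \<noteq> 0" "a2 (Suc k) \<noteq> 0"
      using denoms[rule_format, of "Suc k"] unfolding N_def[symmetric] eq by auto
    have "of_nat (N (Suc k)) * p' C (Suc k) + of_nat (Suc k) * q' C (Suc k) =
      of_real C * (of_nat (N (Suc k)) * p (Suc k) + of_nat (Suc k) * a2 (Suc k)) -
      (of_nat (N (Suc k)) * p k + of_nat (Suc k) * a2 k)"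
      by (simp add: p'_def q'_def algebra_simps)
    then show ?thesis
      unfolding eq norm_divide_le_iff_nonneg_Reals[OF e n nz(1)] norm_divide_le_iff_nonneg_Reals[OF q q nz(2)]
      by (auto simp: q'_def)
  qed
  have "coord_mult_bounded K \<longleftrightarrow> (\<exists>C. \<forall>l. q' C l \<in> \<real>\<^sub>\<ge>\<^sub>0 \<and> of_nat (N l) * p' C l + of_nat l * q' C l \<in> \<real>\<^sub>\<ge>\<^sub>0)"
    unfolding coord_mult_bounded_iff_pos_form[OF nnd] pos_iff ..
  also have "\<dots> \<longleftrightarrow> (\<exists>C. \<forall>k. norm ((of_nat (N (Suc k)) * at1 a1 a2 k - of_nat (CARD('n) - 1) * a2 k) /
          (of_nat (N (Suc k)) * at1 a1 a2 (Suc k) - of_nat (CARD('n) - 1) * a2 (Suc k))) \<le> C \<and>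
    norm (a2 k / a2 (Suc k)) \<le> C)" (is "(\<exists>C. ?L C) \<longleftrightarrow> (\<exists>C. ?R C)")
  proof (rule arg_cong[where f = Ex], rule ext, rule iffI)
    fix C assume "?L C"
    then show "?R C" unfolding term_iff[symmetric] by blast
  next
    fix C assume R: "?R C"
    \<comment> \<open>The quotients say nothing about degree 0, where the condition is that
      \<open>of_real C * a2 0\<close> is nonnegative; it suffices that \<open>C\<close> bounds a
      norm.\<close>
    then have "C \<ge> 0" by (meson norm_ge_zero order_trans)
    then have "q' C 0 \<in> \<real>\<^sub>\<ge>\<^sub>0" using q by (simp add: q'_def)
    moreover have "of_nat (N 0) * p' C 0 + of_nat 0 * q' C 0 = 0" by (simp add: p'_def p0)
    ultimately show "?L C"
      using R unfolding term_iff[symmetric] by (metis nonneg_Reals_zero_I not0_implies_Suc)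
  qed
  also have "\<dots> \<longleftrightarrow> (\<exists>C::real. \<forall>l\<ge>1.
       norm ((of_nat (N l) * at1 a1 a2 (l - 1) - of_nat (CARD('n) - 1) * a2 (l - 1)) /
             (of_nat (N l) * at1 a1 a2 l - of_nat (CARD('n) - 1) * a2 l)) \<le> C \<and>
       norm (a2 (l - 1) / a2 l) \<le> C)"
  proof -
    have "(\<forall>l\<ge>1. Q l) \<longleftrightarrow> (\<forall>k. Q (Suc k))" for Q
      by (metis One_nat_def Suc_le_D Suc_le_mono le0)
    then show ?thesis by (simp only: diff_Suc_1)
  qed
  finally show ?thesis unfolding N_def .
qed

end
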